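(* Let $G$ be a finite solvable group and suppose $\chi\in\mathrm{Irr}(G)$ is primitive and $\chi(1)$ is odd. Then $|\chi(x)|\leq|\chi(x^m)|$ for every $x\in G$ and every integer $m$.
   Context: Characters are complex; $\mathrm{Irr}(G)$ is the set of irreducible characters of $G$. A character $\chi\in\mathrm{Irr}(G)$ is primitive if it cannot be obtained by inducing a character of a proper subgroup of $G$. *)

theory Defs
  imports
    Complex_Main
    "HOL-Algebra.Solvable_Groups"
    "Jordan_Normal_Form.VS_Connect"
begin

text \<open>
  Characters of finite groups over the complex numbers. As the groups are given by carrier sets,
  a character of \<open>G\<close> is represented by a function that is \<open>undefined\<close> outside \<open>carrier G\<close>, so that
  two characters are equal as soon as they agree on \<open>G\<close>.
\<close>

definition mat_trace :: "'a::comm_monoid_add mat \<Rightarrow> 'a"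
  where "mat_trace A = (\<Sum>i<dim_row A. A $$ (i, i))"

definition GL :: "nat \<Rightarrow> complex mat monoid"
  where "GL n = units_of (ring_mat TYPE(complex) n ())"

text \<open>Representations have positive degree; in particular the zero function is not a character.\<close>

definition mat_rep ::
    "('a, 'b) monoid_scheme \<Rightarrow> nat \<Rightarrow> ('a \<Rightarrow> complex mat) \<Rightarrow> bool"
  where "mat_rep G n \<rho> \<longleftrightarrow> n > 0 \<and> \<rho> \<in> hom G (GL n)"

definition irreducible_mat_rep ::
    "('a, 'b) monoid_scheme \<Rightarrow> nat \<Rightarrow> ('a \<Rightarrow> complex mat) \<Rightarrow> bool"
  where "irreducible_mat_rep G n \<rho> \<longleftrightarrow>
    mat_rep G n \<rho> \<and>
    (\<forall>W. VectorSpace.subspace class_ring W (module_vec TYPE(complex) n) \<longrightarrow>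
         (\<forall>g\<in>carrier G. \<forall>w\<in>W. \<rho> g *\<^sub>v w \<in> W) \<longrightarrow>
         W = {0\<^sub>v n} \<or> W = carrier_vec n)"

definition afforded_character ::
    "('a, 'b) monoid_scheme \<Rightarrow> ('a \<Rightarrow> complex mat) \<Rightarrow> 'a \<Rightarrow> complex"
  where "afforded_character G \<rho> = (\<lambda>g\<in>carrier G. mat_trace (\<rho> g))"

definition characters :: "('a, 'b) monoid_scheme \<Rightarrow> ('a \<Rightarrow> complex) set"
  where "characters G = {afforded_character G \<rho> | n \<rho>. mat_rep G n \<rho>}"

definition Irr :: "('a, 'b) monoid_scheme \<Rightarrow> ('a \<Rightarrow> complex) set"
  where "Irr G = {afforded_character G \<rho> | n \<rho>. irreducible_mat_rep G n \<rho>}"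

text \<open>
  Frobenius' formula for the character of the representation of \<open>G\<close> induced from one of
  a subgroup \<open>H\<close> affording \<open>\<psi>\<close>; it is meant for finite \<open>G\<close>.
\<close>

definition induced_character ::
    "('a, 'b) monoid_scheme \<Rightarrow> 'a set \<Rightarrow> ('a \<Rightarrow> complex) \<Rightarrow> 'a \<Rightarrow> complex"
  where "induced_character G H \<psi> =
    (\<lambda>g\<in>carrier G. (\<Sum>x\<in>carrier G.
        let y = x \<otimes>\<^bsub>G\<^esub> g \<otimes>\<^bsub>G\<^esub> inv\<^bsub>G\<^esub> x in if y \<in> H then \<psi> y else 0) / of_nat (card H))"

definition primitive_character :: "('a, 'b) monoid_scheme \<Rightarrow> ('a \<Rightarrow> complex) \<Rightarrow> bool"
  where "primitive_character G \<chi> \<longleftrightarrow>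
    \<chi> \<in> Irr G \<and>
    \<not> (\<exists>H \<psi>. subgroup H G \<and> H \<noteq> carrier G \<and>
             \<psi> \<in> characters (G\<lparr>carrier := H\<rparr>) \<and> \<chi> = induced_character G H \<psi>)"

end

theory Submission
  imports Defs "Jordan_Normal_Form.Spectral_Radius"
begin

text \<open>
  Let \<open>\<rho>\<close> afford \<open>\<chi>\<close>, of degree \<open>n\<close>. The reason for the inequality is that \<open>|\<chi>|\<^sup>2\<close> is a
  permutation character: the algebra of all \<open>n \<times> n\<close> matrices has a basis that \<open>G\<close> permutes by
  conjugation. The trace of the conjugation by \<open>\<rho>(x)\<close> on that algebra is \<open>|\<chi>(x)|\<^sup>2\<close>, so that
  \<open>|\<chi>(x)|\<^sup>2\<close> is the number of basis elements fixed by \<open>x\<close>, and whatever \<open>x\<close> fixes is fixed by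
  every power of \<open>x\<close>.

  To find the basis, one looks for a finite group \<open>E\<close> of matrices that is normalized by \<open>\<rho>(G)\<close>,
  whose commutators are scalar and whose centralizer consists of scalars only. For such an \<open>E\<close>,
  the maps \<open>X \<mapsto> e X e\<close> with \<open>e \<in> E\<close> commute and have finite order, hence are
  simultaneously diagonalizable. Their joint eigenvectors generalize the parity operator of the
  Heisenberg group, conjugation by which inverts \<open>E\<close> modulo scalars. Up to scalars they are
  involutions, the joint eigenspaces have dimension one, and joint eigenvectors of different
  weights are orthogonal for the trace form (lemma \<open>parities_orthogonal\<close>). As \<open>n\<close> is odd,
  exactly one of the two involutions \<open>P\<close>, \<open>- P\<close> has determinant one. This choice is invariant
  under conjugation, and thereby the signed permutation of the involutions becomes a permutation
  (lemma \<open>cj_parities\<close>). For even \<open>n\<close> only the signed version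
  is available.

  The group \<open>E\<close> is built up in layers (lemma \<open>exists_irreducible_heisenberg\<close>). Let \<open>B\<close> be the
  centralizer of a group \<open>E\<close> that need not be large enough yet. Every \<open>g \<in> G\<close> acts on \<open>B\<close> like an
  invertible element of \<open>B\<close>, a case of the Skolem-Noether theorem (lemma \<open>inner_on_B\<close>).
  If \<open>G\<close> acts trivially on \<open>B\<close>, then \<open>B\<close> is scalar by Schur's lemma. Otherwise some term \<open>K\<close> of
  the derived series acts on \<open>B\<close> as a nontrivial abelian group, and the elements of \<open>B\<close> that
  induce the action of elements of \<open>K\<close> enlarge \<open>E\<close> (lemma \<open>enlarge\<close>).

  Primitivity enters through one statement (lemma \<open>abelian_normalized_scalar\<close>): a finite abelian
  group of matrices that is normalized by \<open>\<rho>(G)\<close> is scalar, since otherwise its weight spaces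
  form a system of imprimitivity and \<open>\<chi>\<close> is induced (theorem \<open>idempotent_system_induced\<close>).
  It forces the centre of each of the groups above to be scalar.
\<close>

section \<open>Matrices of finite support\<close>

text \<open>
  Matrices of all sizes, rectangular ones included, are regarded as infinite matrices with finitely
  many nonzero entries. They form a single type that is a ring without unit, so that products are
  always defined and finite sums need no reference to a size. The \<open>n \<times> n\<close> matrices are the
  corner \<open>M n\<close> cut out by the idempotent \<open>idm n\<close>.
\<close>

typedef fsm = "{f :: nat \<Rightarrow> nat \<Rightarrow> complex. \<exists>N. \<forall>i j. N \<le> i \<or> N \<le> j \<longrightarrow> f i j = 0}"
  morphisms ent Fsm
  by (rule exI[of _ "\<lambda>_ _. 0"]) auto

setup_lifting type_definition_fsm

definition Mat :: "nat \<Rightarrow> nat \<Rightarrow> fsm set"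
  where "Mat r c = {A. \<forall>i j. r \<le> i \<or> c \<le> j \<longrightarrow> ent A i j = 0}"

lemma fsm_eqI: "(\<And>i j. ent A i j = ent B i j) \<Longrightarrow> A = B"
  by (simp add: ent_inject[symmetric] fun_eq_iff)

lemma MatI: "(\<And>i j. r \<le> i \<or> c \<le> j \<Longrightarrow> ent A i j = 0) \<Longrightarrow> A \<in> Mat r c"
  by (simp add: Mat_def)

lemma MatD: "A \<in> Mat r c \<Longrightarrow> r \<le> i \<or> c \<le> j \<Longrightarrow> ent A i j = 0"
  by (auto simp: Mat_def)

lemma Mat_mono: "A \<in> Mat r c \<Longrightarrow> r \<le> r' \<Longrightarrow> c \<le> c' \<Longrightarrow> A \<in> Mat r' c'"
  unfolding Mat_def by fastforce

lemma ex_Mat: obtains N where "A \<in> Mat N N"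
  using ent[of A] unfolding Mat_def by auto

lift_definition mk :: "nat \<Rightarrow> nat \<Rightarrow> (nat \<Rightarrow> nat \<Rightarrow> complex) \<Rightarrow> fsm"
  is "\<lambda>r c f i j. if i < r \<and> j < c then f i j else 0"
  subgoal for r c f by (rule exI[of _ "max r c"]) auto
  done

lemma ent_mk [simp]: "ent (mk r c f) i j = (if i < r \<and> j < c then f i j else 0)"
  by transfer simp

lemma mk_in_Mat [simp]: "mk r c f \<in> Mat r c"
  by (rule MatI) auto

instantiation fsm :: ring
begin

lift_definition zero_fsm :: fsm is "\<lambda>_ _. 0" by auto

lift_definition plus_fsm :: "fsm \<Rightarrow> fsm \<Rightarrow> fsm" is "\<lambda>f g i j. f i j + g i j"
  subgoal for f g
    apply clarsimp
    subgoal for N M by (rule exI[of _ "max N M"]) auto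
    done
  done

lift_definition uminus_fsm :: "fsm \<Rightarrow> fsm" is "\<lambda>f i j. - f i j"
  by auto

lift_definition minus_fsm :: "fsm \<Rightarrow> fsm \<Rightarrow> fsm" is "\<lambda>f g i j. f i j - g i j"
  subgoal for f g
    apply clarsimp
    subgoal for N M by (rule exI[of _ "max N M"]) auto
    done
  done

lift_definition times_fsm :: "fsm \<Rightarrow> fsm \<Rightarrow> fsm" is "\<lambda>f g i j. \<Sum>k | f i k \<noteq> 0. f i k * g k j"
  subgoal for f g
    apply clarsimp
    subgoal for N M
      by (rule exI[of _ "max N M"]) auto
    done
  done

lemma ent_zero [simp]: "ent 0 i j = 0" by transfer simp
lemma ent_add [simp]: "ent (A + B) i j = ent A i j + ent B i j" by transfer simp
lemma ent_uminus [simp]: "ent (- A) i j = - ent A i j" by transfer simp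
lemma ent_minus [simp]: "ent (A - B) i j = ent A i j - ent B i j" by transfer simp

lemma ent_mult_left:
  assumes "A \<in> Mat r c" shows "ent (A * B) i j = (\<Sum>k<c. ent A i k * ent B k j)"
proof -
  have "ent (A * B) i j = (\<Sum>k | ent A i k \<noteq> 0. ent A i k * ent B k j)"
    by transfer simp
  also have "\<dots> = (\<Sum>k<c. ent A i k * ent B k j)"
    by (rule sum.mono_neutral_left) (use MatD[OF assms] in \<open>auto intro: leI\<close>)
  finally show ?thesis .
qed

lemma ent_mult_right:
  assumes "B \<in> Mat r c" shows "ent (A * B) i j = (\<Sum>k<r. ent A i k * ent B k j)"
proof -
  obtain N where N: "A \<in> Mat N N" by (rule ex_Mat)
  have A: "A \<in> Mat N (max N r)" by (rule Mat_mono[OF N]) auto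
  have "ent (A * B) i j = (\<Sum>k<max N r. ent A i k * ent B k j)"
    by (rule ent_mult_left[OF A])
  also have "\<dots> = (\<Sum>k<r. ent A i k * ent B k j)"
    by (rule sum.mono_neutral_right) (use MatD[OF assms] in \<open>auto intro: leI\<close>)
  finally show ?thesis .
qed

instance
proof
  fix A B C :: fsm
  show "A * B * C = A * (B * C)"
  proof (rule fsm_eqI)
    fix i j
    obtain N where N: "A \<in> Mat N N" by (rule ex_Mat)
    obtain K where K: "C \<in> Mat K K" by (rule ex_Mat)
    show "ent (A * B * C) i j = ent (A * (B * C)) i j"
      by (simp add: ent_mult_left[OF N] ent_mult_right[OF K] sum_distrib_left sum_distrib_right
          mult.assoc sum.swap[of _ "{..<K}" "{..<N}"])
  qed
  show "(A + B) * C = A * C + B * C"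
  proof (rule fsm_eqI)
    fix i j
    obtain K where K: "C \<in> Mat K K" by (rule ex_Mat)
    show "ent ((A + B) * C) i j = ent (A * C + B * C) i j"
      by (simp add: ent_mult_right[OF K] distrib_right sum.distrib)
  qed
  show "A * (B + C) = A * B + A * C"
  proof (rule fsm_eqI)
    fix i j
    obtain K where K: "A \<in> Mat K K" by (rule ex_Mat)
    show "ent (A * (B + C)) i j = ent (A * B + A * C) i j"
      by (simp add: ent_mult_left[OF K] distrib_left sum.distrib)
  qed
qed (auto intro!: fsm_eqI)

end

lift_definition sc :: "complex \<Rightarrow> fsm \<Rightarrow> fsm" is "\<lambda>c f i j. c * f i j"
  by auto

lemma ent_sc [simp]: "ent (sc c A) i j = c * ent A i j" by transfer simp

interpretation fsm: vector_space sc
  by unfold_locales (auto intro!: fsm_eqI simp: algebra_simps)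

lemma sc_mult_left [simp]: "sc c A * B = sc c (A * B)"
proof (rule fsm_eqI)
  fix i j
  obtain N where N: "B \<in> Mat N N" by (rule ex_Mat)
  show "ent (sc c A * B) i j = ent (sc c (A * B)) i j"
    by (simp add: ent_mult_right[OF N] sum_distrib_left mult.assoc)
qed

lemma sc_mult_right [simp]: "A * sc c B = sc c (A * B)"
proof (rule fsm_eqI)
  fix i j
  obtain N where N: "A \<in> Mat N N" by (rule ex_Mat)
  show "ent (A * sc c B) i j = ent (sc c (A * B)) i j"
    by (simp add: ent_mult_left[OF N] sum_distrib_left mult_ac)
qed

lemma ent_sum: "ent (sum f S) i j = (\<Sum>x\<in>S. ent (f x) i j)"
  by (induction S rule: infinite_finite_induct) auto

abbreviation M :: "nat \<Rightarrow> fsm set" where "M n \<equiv> Mat n n"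

lemma Mat_zero [simp]: "0 \<in> Mat r c" by (simp add: Mat_def)
lemma Mat_add [simp]: "A \<in> Mat r c \<Longrightarrow> B \<in> Mat r c \<Longrightarrow> A + B \<in> Mat r c" by (simp add: Mat_def)
lemma Mat_uminus [simp]: "A \<in> Mat r c \<Longrightarrow> - A \<in> Mat r c" by (simp add: Mat_def)
lemma Mat_minus [simp]: "A \<in> Mat r c \<Longrightarrow> B \<in> Mat r c \<Longrightarrow> A - B \<in> Mat r c" by (simp add: Mat_def)
lemma Mat_sc [simp]: "A \<in> Mat r c \<Longrightarrow> sc a A \<in> Mat r c" by (simp add: Mat_def)
lemma Mat_sum [simp]: "(\<And>x. x \<in> S \<Longrightarrow> f x \<in> Mat r c) \<Longrightarrow> sum f S \<in> Mat r c"
  by (induction S rule: infinite_finite_induct) auto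

lemma Mat_mult: "A \<in> Mat r b \<Longrightarrow> B \<in> Mat b' c \<Longrightarrow> A * B \<in> Mat r c"
  by (rule MatI) (auto simp: ent_mult_left MatD)

lemma M_mult [simp]: "A \<in> M n \<Longrightarrow> B \<in> M n \<Longrightarrow> A * B \<in> M n"
  by (rule Mat_mult)

definition idm :: "nat \<Rightarrow> fsm" where "idm n = mk n n (\<lambda>i j. if i = j then 1 else 0)"

definition munit :: "nat \<Rightarrow> nat \<Rightarrow> fsm"
  where "munit a b = mk (Suc a) (Suc b) (\<lambda>i j. if i = a \<and> j = b then 1 else 0)"

lemma idm_M [simp]: "idm n \<in> M n" by (simp add: idm_def)

lemma ent_idm: "ent (idm n) i j = (if i = j then if i < n then 1 else 0 else 0)" by (auto simp: idm_def)
lemma ent_munit: "ent (munit a b) i j = (if i = a then if j = b then 1 else 0 else 0)"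
  by (auto simp: munit_def)

lemma munit_Mat [simp]: "a < r \<Longrightarrow> b < c \<Longrightarrow> munit a b \<in> Mat r c"
  by (rule MatI) (auto simp: ent_munit)

lemma idm_mult [simp]: "A \<in> Mat n c \<Longrightarrow> idm n * A = A"
  by (rule fsm_eqI)
    (auto simp: ent_mult_left[OF idm_M] ent_idm if_distrib[of "\<lambda>x. x * _"] MatD cong: if_cong)

lemma mult_idm [simp]: "A \<in> Mat r n \<Longrightarrow> A * idm n = A"
  by (rule fsm_eqI)
    (auto simp: ent_mult_right[OF idm_M] ent_idm if_distrib[of "\<lambda>x. _ * x"] MatD cong: if_cong)

lemmas idm_mult_M [simp] = idm_mult[of _ n n] for n
lemmas mult_idm_M [simp] = mult_idm[of _ n n] for n

lemma ent_munit_mult: "ent (munit a b * A) i j = (if i = a then ent A b j else 0)"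
proof -
  have u: "munit a b \<in> Mat (Suc a) (Suc b)" by auto
  show ?thesis unfolding ent_mult_left[OF u]
    by (simp add: ent_munit if_distrib[of "\<lambda>x. x * _"] cong: if_cong)
qed

lemma ent_mult_munit: "ent (A * munit a b) i j = (if j = b then ent A i a else 0)"
proof -
  have u: "munit a b \<in> Mat (Suc a) (Suc b)" by auto
  show ?thesis unfolding ent_mult_right[OF u]
    by (simp add: ent_munit if_distrib[of "\<lambda>x. _ * x"] cong: if_cong)
qed

lemma munit_mult_mult:
  "munit a i * A * munit j b = sc (ent A i j) (munit a b)"
  by (rule fsm_eqI) (auto simp: ent_munit_mult ent_mult_munit ent_munit mult.assoc)

lemma munit_mult: "munit a i * munit j b = (if i = j then munit a b else 0)"
  by (rule fsm_eqI) (auto simp: ent_munit_mult ent_munit)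

lemma idm_sum_munit: "idm n = (\<Sum>i<n. munit i i)"
  by (rule fsm_eqI) (auto simp: ent_idm ent_sum ent_munit)

lemma idm_nonzero: "n > 0 \<Longrightarrow> idm n \<noteq> 0"
  using ent_idm[of n 0 0] by auto

text \<open>
  From \<open>z e\<^sub>i\<^sub>i = z e\<^sub>i\<^sub>0 e\<^sub>0\<^sub>i = e\<^sub>i\<^sub>0 z e\<^sub>0\<^sub>i\<close> one reads off that \<open>z\<close> acts on each \<open>e\<^sub>i\<^sub>i\<close> as its entry \<open>z\<^sub>0\<^sub>0\<close>.
\<close>

lemma central_scalar:
  assumes "n > 0" "z \<in> M n" "\<And>X. X \<in> M n \<Longrightarrow> z * X = X * z"
  shows "\<exists>c. z = sc c (idm n)"
proof -
  have "z * munit i i = sc (ent z 0 0) (munit i i)" if "i < n" for i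
  proof -
    have "z * munit i i = z * munit i 0 * munit 0 i" by (simp add: munit_mult mult.assoc)
    also have "\<dots> = munit i 0 * z * munit 0 i" using assms that by simp
    finally show ?thesis by (simp add: munit_mult_mult)
  qed
  hence "z * idm n = sc (ent z 0 0) (idm n)"
    by (simp add: idm_sum_munit sum_distrib_left fsm.scale_sum_right)
  thus ?thesis using assms by auto
qed

subsection \<open>Trace\<close>

definition tr :: "fsm \<Rightarrow> complex" where "tr A = (\<Sum>i | ent A i i \<noteq> 0. ent A i i)"

lemma tr_eq: "A \<in> M n \<Longrightarrow> tr A = (\<Sum>i<n. ent A i i)"
  unfolding tr_def by (rule sum.mono_neutral_left) (auto simp: MatD not_le[symmetric])

lemma tr_add: "tr (A + B) = tr A + tr B"
proof -
  obtain N where "A \<in> M N" by (rule ex_Mat)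
  moreover obtain K where "B \<in> M K" by (rule ex_Mat)
  ultimately have "A \<in> M (max N K)" "B \<in> M (max N K)" by (auto elim: Mat_mono)
  thus ?thesis by (simp add: tr_eq[of _ "max N K"] sum.distrib)
qed

lemma tr_zero [simp]: "tr 0 = 0" by (simp add: tr_def)

lemma tr_sc [simp]: "tr (sc c A) = c * tr A"
proof -
  obtain N where "A \<in> M N" by (rule ex_Mat)
  thus ?thesis by (simp add: tr_eq[of _ N] sum_distrib_left)
qed

lemma tr_sum: "tr (sum f S) = (\<Sum>x\<in>S. tr (f x))"
  by (induction S rule: infinite_finite_induct) (auto simp: tr_add)

lemma tr_idm [simp]: "tr (idm n) = of_nat n"
  by (simp add: tr_eq[of _ n] ent_idm)

lemma tr_mult: "A \<in> M n \<Longrightarrow> B \<in> M n \<Longrightarrow> tr (A * B) = (\<Sum>i<n. \<Sum>j<n. ent A i j * ent B j i)"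
  by (simp add: tr_eq[of _ n] ent_mult_left[of A n n])

lemma tr_commute: "tr (A * B) = tr (B * A)"
proof -
  obtain N where "A \<in> M N" by (rule ex_Mat)
  moreover obtain K where "B \<in> M K" by (rule ex_Mat)
  ultimately have AB: "A \<in> M (max N K)" "B \<in> M (max N K)" by (auto elim: Mat_mono)
  show ?thesis unfolding tr_mult[OF AB] tr_mult[OF AB(2) AB(1)]
    by (subst sum.swap) (simp add: mult.commute)
qed

lemma tr_munit_mult: "tr (munit j i * A) = ent A i j"
proof -
  obtain N where N: "A \<in> M N" by (rule ex_Mat)
  define K where "K = max N (Suc (max i j))"
  have "A \<in> M K" "munit j i \<in> M K" by (auto intro: Mat_mono[OF N] simp: K_def)
  moreover have "i < K" "j < K" by (auto simp: K_def)
  ultimately show ?thesis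
    by (simp add: tr_eq[of _ K] ent_munit_mult)
qed

lemma tr_nondegenerate:
  assumes "X \<in> M n" "\<And>Y. Y \<in> M n \<Longrightarrow> tr (X * Y) = 0"
  shows "X = 0"
proof (rule fsm_eqI)
  fix i j
  show "ent X i j = ent 0 i j"
  proof (cases "i < n \<and> j < n")
    case True
    hence "tr (X * munit j i) = 0" by (intro assms) simp
    thus ?thesis by (simp add: tr_commute[of X] tr_munit_mult)
  qed (use MatD[OF assms(1)] in \<open>auto simp: not_less\<close>)
qed

subsection \<open>Finite support versus fixed dimensions\<close>

definition of_mat :: "complex mat \<Rightarrow> fsm"
  where "of_mat A = mk (dim_row A) (dim_col A) (\<lambda>i j. A $$ (i, j))"

definition to_mat :: "nat \<Rightarrow> nat \<Rightarrow> fsm \<Rightarrow> complex mat"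
  where "to_mat r c A = mat r c (\<lambda>(i, j). ent A i j)"

lemma to_mat_carrier [simp]: "to_mat r c A \<in> carrier_mat r c" by (simp add: to_mat_def)

lemma of_mat_Mat [simp]: "A \<in> carrier_mat r c \<Longrightarrow> of_mat A \<in> Mat r c"
  by (auto simp: of_mat_def)

lemma of_mat_mult:
  assumes "A \<in> carrier_mat r b" "B \<in> carrier_mat b c"
  shows "of_mat (A * B) = of_mat A * of_mat B"
proof (rule fsm_eqI)
  fix i j
  have "of_mat A \<in> Mat r b" using assms by simp
  hence "ent (of_mat A * of_mat B) i j = (\<Sum>k<b. ent (of_mat A) i k * ent (of_mat B) k j)"
    by (rule ent_mult_left)
  thus "ent (of_mat (A * B)) i j = ent (of_mat A * of_mat B) i j"
    using assms by (auto simp: of_mat_def scalar_prod_def atLeast0LessThan)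
qed

lemma of_mat_one: "of_mat (1\<^sub>m n) = idm n"
  by (rule fsm_eqI) (auto simp: of_mat_def ent_idm)

lemma to_mat_of_mat [simp]: "A \<in> carrier_mat r c \<Longrightarrow> to_mat r c (of_mat A) = A"
  by (auto simp: to_mat_def of_mat_def intro!: eq_matI)

lemma to_mat_mult:
  "A \<in> Mat r b \<Longrightarrow> to_mat r c (A * B) = to_mat r b A * to_mat b c B"
  by (rule eq_matI) (auto simp: to_mat_def ent_mult_left scalar_prod_def atLeast0LessThan)

lemma to_mat_idm [simp]: "to_mat n n (idm n) = 1\<^sub>m n"
  by (rule eq_matI) (auto simp: to_mat_def ent_idm)

lemma to_mat_sc: "to_mat r c (sc a A) = a \<cdot>\<^sub>m to_mat r c A"
  by (rule eq_matI) (auto simp: to_mat_def)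

lemma to_mat_inject: "A \<in> Mat r c \<Longrightarrow> B \<in> Mat r c \<Longrightarrow> to_mat r c A = to_mat r c B \<Longrightarrow> A = B"
proof (rule fsm_eqI)
  fix i j assume *: "A \<in> Mat r c" "B \<in> Mat r c" "to_mat r c A = to_mat r c B"
  show "ent A i j = ent B i j"
  proof (cases "i < r \<and> j < c")
    case True
    thus ?thesis using arg_cong[OF *(3), of "\<lambda>X. X $$ (i, j)"] by (simp add: to_mat_def)
  qed (use * in \<open>auto simp: MatD not_less\<close>)
qed

lemma tr_of_mat: "A \<in> carrier_mat n n \<Longrightarrow> tr (of_mat A) = mat_trace A"
  by (auto simp: tr_eq[of _ n] mat_trace_def of_mat_def intro!: sum.cong)

lemma mat_trace_to_mat: "A \<in> M n \<Longrightarrow> mat_trace (to_mat n n A) = tr A"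
  by (simp add: tr_eq[of _ n] mat_trace_def to_mat_def)

lemma left_inverse_right_inverse:
  assumes "A \<in> M n" "B \<in> M n" "A * B = idm n"
  shows "B * A = idm n"
proof -
  have "to_mat n n A * to_mat n n B = 1\<^sub>m n"
    using to_mat_mult[of A n n n B] assms by simp
  hence "to_mat n n B * to_mat n n A = 1\<^sub>m n"
    by (rule mat_mult_left_right_inverse[rotated 2]) auto
  thus ?thesis using assms by (intro to_mat_inject[of _ n n]) (auto simp: to_mat_mult)
qed

definition fdet :: "nat \<Rightarrow> fsm \<Rightarrow> complex" where "fdet n A = det (to_mat n n A)"

lemma fdet_mult: "A \<in> M n \<Longrightarrow> fdet n (A * B) = fdet n A * fdet n B"
  unfolding fdet_def by (simp add: to_mat_mult det_mult[of _ n])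

lemma fdet_idm [simp]: "fdet n (idm n) = 1" by (simp add: fdet_def)

lemma fdet_sc: "fdet n (sc c A) = c ^ n * fdet n A"
  unfolding fdet_def by (simp add: to_mat_sc) (simp add: to_mat_def)

section \<open>Simultaneous diagonalization\<close>

lemma sum_powers_root_of_unity:
  fixes k j :: nat
  assumes "j < k"
  shows "(\<Sum>l<k. cis (2 * pi / k) ^ (l * j)) = (if j = 0 then of_nat k else 0)"
proof (cases "j = 0")
  case False
  define z where "z = cis (2 * pi * j / k)"
  have z: "cis (2 * pi / k) ^ (l * j) = z ^ l" for l
    by (simp add: z_def DeMoivre mult_ac)
  have inj: "inj_on (\<lambda>l. cis (2 * pi * real l / real k)) {..<k}"
    using bij_betw_roots_unity[of k] assms by (auto simp: bij_betw_def)
  have "z \<noteq> 1"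
    using inj_onD[OF inj, of j 0] assms False by (auto simp: z_def)
  moreover have "z ^ k = 1"
    using assms by (simp add: z_def DeMoivre mult_ac)
        (use cis_multiple_2pi[of "real j"] in \<open>simp add: mult_ac\<close>)
  ultimately show ?thesis
    unfolding z using False by (simp add: geometric_sum)
qed simp

text \<open>The components of \<open>w\<close> are the averages of the vectors \<open>\<omega>\<^sup>l\<^sup>j D\<^sup>j w\<close> over \<open>j\<close>, for the
  powers \<open>\<omega>\<^sup>l\<close> of a primitive \<open>k\<close>-th root of unity.\<close>

lemma finite_order_eigen_decomposition:
  assumes add: "\<And>x y. D (x + y) = D x + D y" and hom: "\<And>c x. D (sc c x) = sc c (D x)"
    and k: "k > 0" "(D ^^ k) w = w"
    and W: "fsm.subspace W" "\<And>x. x \<in> W \<Longrightarrow> D x \<in> W" "w \<in> W"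
  obtains f where "w = (\<Sum>l<k. f l)" "\<And>l. l < k \<Longrightarrow> f l \<in> W \<and> (\<exists>c. D (f l) = sc c (f l))"
proof -
  define \<omega> where "\<omega> = cis (2 * pi / k)"
  define h where "h l j = sc (\<omega> ^ (l * j)) ((D ^^ j) w)" for l j
  define f where "f l = sc (1 / of_nat k) (\<Sum>j<k. h l j)" for l
  have \<omega>: "\<omega> \<noteq> 0" "\<omega> ^ k = 1"
    using k by (auto simp: \<omega>_def DeMoivre)
  have DW: "(D ^^ j) w \<in> W" for j
    by (induction j) (use W in auto)
  have fW: "f l \<in> W" for l
    unfolding f_def h_def using W(1) DW by (auto intro!: fsm.subspace_scale fsm.subspace_sum)
  have D0: "D 0 = 0" using hom[of 0 0] by simp
  have Dsum: "D (sum g A) = (\<Sum>x\<in>A. D (g x))" for g :: "nat \<Rightarrow> fsm" and A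
    by (induction A rule: infinite_finite_induct) (auto simp: add D0)
  have "sc (\<omega> ^ l) (D (f l)) = f l" for l
  proof -
    have "\<omega> ^ (l * k) = 1" by (metis \<omega>(2) mult.commute power_mult power_one)
    hence hk: "h l k = h l 0" using k by (simp add: h_def)
    have "(\<Sum>j<k. h l (Suc j)) = (\<Sum>j<k. h l j)"
      using sum.lessThan_Suc_shift[of "h l" k] sum.lessThan_Suc[of "h l" k] hk
      by (simp add: add.commute)
    moreover have "sc (\<omega> ^ l) (D (h l j)) = h l (Suc j)" for j
      by (simp add: h_def hom power_add)
    moreover have "sc (\<omega> ^ l) (D (f l)) = sc (1 / of_nat k) (\<Sum>j<k. sc (\<omega> ^ l) (D (h l j)))"
      by (simp add: f_def hom Dsum fsm.scale_sum_right)
    ultimately show ?thesis by (simp add: f_def)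
  qed
  hence "sc (inverse (\<omega> ^ l)) (sc (\<omega> ^ l) (D (f l))) = sc (inverse (\<omega> ^ l)) (f l)" for l
    by simp
  hence eig: "D (f l) = sc (inverse (\<omega> ^ l)) (f l)" for l
    using \<omega> by simp
  have "(\<Sum>l<k. f l) = sc (1 / of_nat k) (\<Sum>l<k. \<Sum>j<k. h l j)"
    by (simp add: f_def fsm.scale_sum_right)
  also have "(\<Sum>l<k. \<Sum>j<k. h l j) = (\<Sum>j<k. \<Sum>l<k. h l j)" by (rule sum.swap)
  also have "(\<Sum>j<k. \<Sum>l<k. h l j) = (\<Sum>j<k. if j = 0 then sc (of_nat k) w else 0)"
    by (rule sum.cong)
      (auto simp: h_def fsm.scale_sum_left[symmetric] \<omega>_def sum_powers_root_of_unity)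
  also have "\<dots> = sc (of_nat k) w" using k by simp
  finally have "w = (\<Sum>l<k. f l)" using k by simp
  thus ?thesis using fW eig that[of f] by blast
qed

text \<open>
  Simultaneous diagonalization, in a form that avoids dimensions and direct sums: a set that is
  closed under addition contains \<open>W\<close> as soon as it contains the joint eigenvectors in \<open>W\<close>. In the
  induction step the hypothesis is applied to the eigenspaces of one operator, which the others
  leave invariant.
\<close>

lemma simultaneous_eigenvectors_generate:
  assumes "finite F" and "fsm.subspace W"
    and "\<And>D x y. D \<in> F \<Longrightarrow> D (x + y) = D x + D y"
    and "\<And>D c x. D \<in> F \<Longrightarrow> D (sc c x) = sc c (D x)"
    and "\<And>D x. D \<in> F \<Longrightarrow> x \<in> W \<Longrightarrow> D x \<in> W"
    and "\<And>D. D \<in> F \<Longrightarrow> \<exists>k>0. \<forall>x\<in>W. (D ^^ k) x = x"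
    and "\<And>D D' x. D \<in> F \<Longrightarrow> D' \<in> F \<Longrightarrow> x \<in> W \<Longrightarrow> D (D' x) = D' (D x)"
    and Q: "0 \<in> Q" "\<And>x y. x \<in> Q \<Longrightarrow> y \<in> Q \<Longrightarrow> x + y \<in> Q"
    and "\<And>x. x \<in> W \<Longrightarrow> (\<And>D. D \<in> F \<Longrightarrow> \<exists>c. D x = sc c x) \<Longrightarrow> x \<in> Q"
  shows "W \<subseteq> Q"
  using assms(1-7,10)
proof (induction F arbitrary: W rule: finite_induct)
  case empty
  thus ?case by auto
next
  case (insert D F)
  note add = insert.prems(2) and hom = insert.prems(3) and comm = insert.prems(6)
  define E where "E c = {x \<in> W. D x = sc c x}" for c
  have "E c \<subseteq> Q" for c
  proof (rule insert.IH)
    show "fsm.subspace (E c)"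
      using insert.prems(1) hom[of D 0 0]
      by (auto simp: E_def fsm.subspace_def add hom fsm.scale_right_distrib fsm.scale_left_commute)
    show "D' x \<in> E c" if "D' \<in> F" "x \<in> E c" for D' x
      using that comm[of D D' x] insert.prems(4)[of D' x] hom[of D' c x] by (auto simp: E_def)
    show "\<exists>k>0. \<forall>x\<in>E c. (D' ^^ k) x = x" if "D' \<in> F" for D'
      using insert.prems(5)[of D'] that by (auto simp: E_def)
    show "x \<in> Q" if "x \<in> E c" "\<And>D'. D' \<in> F \<Longrightarrow> \<exists>c. D' x = sc c x" for x
      using that by (intro insert.prems(7)) (auto simp: E_def)
  qed (use insert.prems in \<open>auto simp: E_def\<close>)
  show ?case
  proof
    fix w assume w: "w \<in> W"
    obtain k where k: "k > 0" "(D ^^ k) w = w" using insert.prems(5)[of D] w by auto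
    obtain f where f: "w = (\<Sum>l<k. f l)"
      "\<And>l. l < k \<Longrightarrow> f l \<in> W \<and> (\<exists>c. D (f l) = sc c (f l))"
      by (rule finite_order_eigen_decomposition[of D k w W])
        (use k w insert.prems in auto)
    have "f l \<in> Q" if "l < k" for l
      using f(2)[OF that] \<open>\<And>c. E c \<subseteq> Q\<close> by (auto simp: E_def)
    hence "(\<Sum>l\<in>A. f l) \<in> Q" if "A \<subseteq> {..<k}" for A
      using finite_subset[OF that] that
      by (induction A rule: infinite_finite_induct) (auto intro: Q)
    thus "w \<in> Q" unfolding f(1) by auto
  qed
qed

section \<open>Idempotent matrices\<close>

text \<open>
  The columns of \<open>P\<close> are a basis of the image of \<open>e\<close>. Take \<open>P\<close> and \<open>Q\<close> with as many columns and
  rows as possible. If \<open>P Q\<close> is not yet all of \<open>e\<close>, a nonzero entry of the idempotent \<open>e - P Q\<close>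
  yields one more column for \<open>P\<close> and one more row for \<open>Q\<close>. The factorization serves twice: it turns
  the action on the image of \<open>e\<close> into a matrix representation, and it shows that traces of
  idempotents are natural numbers.
\<close>

lemma idempotent_factorization:
  assumes e: "e \<in> M n" "e * e = e"
  obtains r P Q where "P \<in> Mat n r" "Q \<in> Mat r n" "P * Q = e" "Q * P = idm r"
proof -
  define A where "A r P Q \<longleftrightarrow> P \<in> Mat n r \<and> Q \<in> Mat r n \<and> Q * P = idm r \<and> e * P = P \<and> Q * e = Q"
    for r P Q
  have "A 0 0 0" by (auto simp: A_def idm_sum_munit)
  moreover have "r \<le> n" if "A r P Q" for r P Q
  proof (rule ccontr)
    assume "\<not> r \<le> n"
    moreover from this have "P \<in> M r" "Q \<in> M r" "P * Q \<in> M n"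
      using that by (auto simp: A_def elim: Mat_mono Mat_mult)
    \<comment> \<open>Otherwise \<open>P * Q\<close> would be \<open>idm r\<close>, although its rows beyond the first \<open>n\<close> vanish.\<close>
    ultimately show False
      using left_inverse_right_inverse[of Q r P] that MatD[of "P * Q" n n n n]
      by (auto simp: A_def ent_idm)
  qed
  ultimately obtain r where r: "\<exists>P Q. A r P Q" "\<And>r'. \<exists>P Q. A r' P Q \<Longrightarrow> r' \<le> r"
    using Greatest_le_nat[of "\<lambda>r. \<exists>P Q. A r P Q" _ n] GreatestI_nat[of "\<lambda>r. \<exists>P Q. A r P Q" 0 n]
    by metis
  from r(1) obtain P Q where "A r P Q" by blast
  hence PQ: "P \<in> Mat n r" "Q \<in> Mat r n" "Q * P = idm r" "e * P = P" "Q * e = Q"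
    by (auto simp: A_def)
  define d where "d = e - P * Q"
  have QPX: "Q * (P * X) = idm r * X" for X by (simp add: PQ(3) flip: mult.assoc)
  have ePX: "e * (P * X) = P * X" for X by (simp add: PQ(4) flip: mult.assoc)
  have "P * Q \<in> M n" using PQ by (blast intro: Mat_mult)
  hence d: "d \<in> M n" "d * d = d" "e * d = d" "d * e = d" "Q * d = 0" "d * P = 0"
    using e PQ by (auto simp: d_def algebra_simps QPX ePX)
  have "d = 0"
  proof (rule ccontr)
    assume "d \<noteq> 0"
    then obtain i j where ij: "ent d i j \<noteq> 0" using fsm_eqI[of d 0] by auto
    hence ij': "i < n" "j < n" using MatD[OF d(1)] by (auto simp: not_le[symmetric])
    define v where "v = d * munit j r"
    define u where "u = sc (1 / ent d i j) (munit r i * d)"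
    have dX: "d * (d * X) = d * X" "Q * (d * X) = 0" "e * (d * X) = d * X" for X
      by (simp_all add: d flip: mult.assoc)
    have "u * v = sc (1 / ent d i j) (munit r i * d * munit j r)"
      by (simp add: u_def v_def mult.assoc dX)
    hence uv: "u * v = munit r r" using ij by (simp add: munit_mult_mult)
    have "A (Suc r) (P + v) (Q + u)"
      unfolding A_def
    proof (intro conjI)
      have "v \<in> Mat n (Suc r)" "u \<in> Mat (Suc r) n"
        using ij' Mat_mult[OF d(1) munit_Mat[of j n r "Suc r"]]
          Mat_mult[OF munit_Mat[of r "Suc r" i n] d(1)] by (auto simp: u_def v_def)
      thus "P + v \<in> Mat n (Suc r)" "Q + u \<in> Mat (Suc r) n"
        using Mat_mono[OF PQ(1)] Mat_mono[OF PQ(2)] by auto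
      have "u * P = 0" "Q * v = 0" by (simp_all add: u_def v_def mult.assoc d dX)
      thus "(Q + u) * (P + v) = idm (Suc r)"
        by (simp add: algebra_simps PQ uv idm_sum_munit)
      show "e * (P + v) = P + v" by (simp add: distrib_left PQ v_def dX)
      show "(Q + u) * e = Q + u" by (simp add: distrib_right PQ u_def mult.assoc d)
    qed
    thus False using r(2)[of "Suc r"] by auto
  qed
  thus ?thesis using that[of P r Q] PQ by (simp add: d_def)
qed

lemma tr_idempotent:
  assumes "e \<in> M n" "e * e = e"
  shows "tr e \<in> \<nat>"
proof -
  obtain r P Q where "P * Q = e" "Q * P = idm r"
    using idempotent_factorization[OF assms] by metis
  hence "tr e = of_nat r" using tr_commute[of P Q] by simp
  thus ?thesis by simp
qed

section \<open>Finite matrix groups\<close>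

definition minv :: "nat \<Rightarrow> fsm \<Rightarrow> fsm"
  where "minv n a = (SOME b. b \<in> M n \<and> a * b = idm n \<and> b * a = idm n)"

locale mgrp =
  fixes n :: nat and S :: "fsm set"
  assumes finite_S: "finite S" and S_M: "S \<subseteq> M n" and one_S: "idm n \<in> S"
    and mult_S: "\<And>s t. s \<in> S \<Longrightarrow> t \<in> S \<Longrightarrow> s * t \<in> S"
    and ex_inv_S: "\<And>s. s \<in> S \<Longrightarrow> \<exists>t\<in>S. s * t = idm n \<and> t * s = idm n"
begin

lemma in_M [simp]: "s \<in> S \<Longrightarrow> s \<in> M n" using S_M by auto

lemma inv_facts: assumes "s \<in> S"
  shows "minv n s \<in> S" "s * minv n s = idm n" "minv n s * s = idm n"
proof -
  obtain t where t: "t \<in> S" "s * t = idm n" "t * s = idm n" using ex_inv_S assms by blast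
  hence "\<exists>b. b \<in> M n \<and> s * b = idm n \<and> b * s = idm n" using S_M by blast
  from someI_ex[OF this]
  have *: "minv n s \<in> M n \<and> s * minv n s = idm n \<and> minv n s * s = idm n"
    unfolding minv_def .
  have "minv n s = (t * s) * minv n s" using * t by simp
  also have "\<dots> = t * (s * minv n s)" by (simp only: mult.assoc)
  also have "\<dots> = t" using * t S_M by auto
  finally have "minv n s = t" .
  thus "minv n s \<in> S" "s * minv n s = idm n" "minv n s * s = idm n" using t by auto
qed

lemma inv_cancel [simp]:
  assumes "s \<in> S" "x \<in> M n"
  shows "s * (minv n s * x) = x" "minv n s * (s * x) = x"
  using assms by (simp_all add: inv_facts flip: mult.assoc)

lemma inv_M [simp]: "s \<in> S \<Longrightarrow> minv n s \<in> M n" by (simp add: inv_facts)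

lemma inv_unique: "s \<in> S \<Longrightarrow> t \<in> M n \<Longrightarrow> s * t = idm n \<Longrightarrow> minv n s = t"
  using inv_cancel(2)[of s t] by simp

lemma inv_mult: "s \<in> S \<Longrightarrow> t \<in> S \<Longrightarrow> minv n (s * t) = minv n t * minv n s"
  by (intro inv_unique) (auto simp: mult_S inv_facts mult.assoc)

lemma bij_left: "s \<in> S \<Longrightarrow> bij_betw ((*) s) S S"
  by (rule bij_betwI[of _ _ _ "(*) (minv n s)"]) (auto simp: mult_S inv_facts)

lemma bij_right: "s \<in> S \<Longrightarrow> bij_betw (\<lambda>t. t * s) S S"
  by (rule bij_betwI[of _ _ _ "\<lambda>t. t * minv n s"]) (auto simp: mult_S inv_facts mult.assoc)

lemma sum_left: "s \<in> S \<Longrightarrow> (\<Sum>t\<in>S. f (s * t)) = (\<Sum>t\<in>S. f t)"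
  by (rule sum.reindex_bij_betw[OF bij_left])

lemma sum_right: "s \<in> S \<Longrightarrow> (\<Sum>t\<in>S. f (t * s)) = (\<Sum>t\<in>S. f t)"
  by (rule sum.reindex_bij_betw[OF bij_right])

lemma card_pos: "card S > 0"
  using one_S finite_S by (auto simp: card_gt_0_iff)

lemma finite_order:
  assumes s: "s \<in> S"
  obtains k where "k > 0" "((*) s ^^ k) (idm n) = idm n"
proof -
  define p where "p k = ((*) s ^^ k) (idm n)" for k
  have pS: "p k \<in> S" for k by (induction k) (auto simp: p_def one_S mult_S s)
  have cancel: "p (i + d) = p i \<Longrightarrow> p d = p 0" for i d
  proof (induction i)
    case (Suc i)
    hence "minv n s * (s * p (i + d)) = minv n s * (s * p i)" by (simp add: p_def)
    thus ?case using Suc.IH pS[of i] pS[of "i + d"] s by simp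
  qed simp
  have "\<not> inj p"
    using finite_subset[of "range p" S] finite_S pS range_inj_infinite[of p] by blast
  then obtain i j where "p i = p j" "i < j" unfolding inj_def by (metis nat_neq_iff)
  hence "p (j - i) = p 0" using cancel[of i "j - i"] by simp
  thus ?thesis using that[of "j - i"] \<open>i < j\<close> by (simp add: p_def)
qed

lemma funpow_left: "x \<in> M n \<Longrightarrow> s \<in> S \<Longrightarrow> ((*) s ^^ k) x = ((*) s ^^ k) (idm n) * x"
  by (induction k) (simp_all add: mult.assoc)

text \<open>
  The maps \<open>x \<mapsto> s x s\<close> have finite order as well, which makes them diagonalizable.
\<close>

lemma funpow_sandwich:
  assumes "x \<in> M n" "s \<in> S"
  shows "((\<lambda>x. s * x * s) ^^ k) x = ((*) s ^^ k) (idm n) * x * ((*) s ^^ k) (idm n)"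
proof (induction k)
  case (Suc k)
  have "((*) s ^^ k) (idm n) * s = s * ((*) s ^^ k) (idm n)"
    using assms by (induction k) (simp_all add: mult.assoc)
  thus ?case using Suc by (simp add: mult.assoc)
qed (use assms in simp)

end

subsection \<open>Linear characters and their idempotents\<close>

text \<open>
  The restriction to extensional functions makes characters that agree on \<open>S\<close> equal and leaves
  only finitely many of them.
\<close>

definition lin_chars :: "fsm set \<Rightarrow> (fsm \<Rightarrow> complex) set"
  where "lin_chars S = {l \<in> extensional S.
    (\<forall>s\<in>S. l s \<noteq> 0) \<and> (\<forall>s\<in>S. \<forall>t\<in>S. l (s * t) = l s * l t)}"

definition char_idem :: "fsm set \<Rightarrow> (fsm \<Rightarrow> complex) \<Rightarrow> fsm"
  where "char_idem S l = sc (1 / of_nat (card S)) (\<Sum>s\<in>S. sc (inverse (l s)) s)"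

context mgrp
begin

lemma lin_char_root_of_unity:
  assumes "l \<in> lin_chars S" "((*) s ^^ k) (idm n) = idm n" "s \<in> S"
  shows "l s ^ k = 1"
proof -
  have "l (idm n * idm n) = l (idm n) * l (idm n)" "l (idm n) \<noteq> 0"
    using assms(1) one_S unfolding lin_chars_def by blast+
  hence l: "l (idm n) = 1" by simp
  have "((*) s ^^ j) (idm n) \<in> S \<and> l (((*) s ^^ j) (idm n)) = l s ^ j" for j
    by (induction j) (use l assms one_S mult_S in \<open>auto simp: lin_chars_def\<close>)
  from this[of k] show ?thesis using assms(2) l by simp
qed

lemma norm_lin_char:
  assumes "l \<in> lin_chars S" "s \<in> S"
  shows "norm (l s) = 1"
proof -
  obtain k where "k > 0" "((*) s ^^ k) (idm n) = idm n" using finite_order[OF assms(2)] .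
  thus ?thesis using lin_char_root_of_unity[OF assms(1) _ assms(2), of k]
    by (metis norm_one norm_power power_eq_1_iff norm_ge_zero not_gr_zero)
qed

lemma finite_lin_chars: "finite (lin_chars S)"
proof -
  have "\<exists>k>0. ((*) s ^^ k) (idm n) = idm n" if "s \<in> S" for s
    using finite_order[OF that] by blast
  then obtain k where k: "\<And>s. s \<in> S \<Longrightarrow> k s > 0 \<and> ((*) s ^^ k s) (idm n) = idm n" by metis
  have "lin_chars S \<subseteq> PiE S (\<lambda>s. {c. c ^ k s = 1})"
    using lin_char_root_of_unity k by (auto simp: PiE_def) (auto simp: lin_chars_def)
  moreover have "finite (PiE S (\<lambda>s. {c :: complex. c ^ k s = 1}))"
    using k by (intro finite_PiE finite_S) (auto intro!: finite_nth_roots simp: Suc_le_eq)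
  ultimately show ?thesis by (rule finite_subset)
qed

lemma char_idem_M [simp]: "char_idem S l \<in> M n"
  by (auto simp: char_idem_def)

lemma mult_char_idem:
  assumes "l \<in> lin_chars S" "t \<in> S"
  shows "t * char_idem S l = sc (l t) (char_idem S l)" (is ?L)
    and "char_idem S l * t = sc (l t) (char_idem S l)" (is ?R)
proof -
  have l: "l s \<noteq> 0" "l (s * u) = l s * l u" if "s \<in> S" "u \<in> S" for s u
    using assms that by (auto simp: lin_chars_def)
  have "(\<Sum>s\<in>S. sc (inverse (l s)) (t * s)) = (\<Sum>s\<in>S. sc (l t * inverse (l (t * s))) (t * s))"
    using assms l by (intro sum.cong) auto
  also have "\<dots> = (\<Sum>s\<in>S. sc (l t * inverse (l s)) s)" by (rule sum_left[OF assms(2)])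
  finally have "t * char_idem S l = sc (1 / of_nat (card S)) (\<Sum>s\<in>S. sc (l t * inverse (l s)) s)"
    by (simp add: char_idem_def sum_distrib_left)
  thus ?L by (simp add: char_idem_def fsm.scale_sum_right mult_ac)
  have "(\<Sum>s\<in>S. sc (inverse (l s)) (s * t)) = (\<Sum>s\<in>S. sc (l t * inverse (l (s * t))) (s * t))"
    using assms l by (intro sum.cong) auto
  also have "\<dots> = (\<Sum>s\<in>S. sc (l t * inverse (l s)) s)" by (rule sum_right[OF assms(2)])
  finally have "char_idem S l * t = sc (1 / of_nat (card S)) (\<Sum>s\<in>S. sc (l t * inverse (l s)) s)"
    by (simp add: char_idem_def sum_distrib_right)
  thus ?R by (simp add: char_idem_def fsm.scale_sum_right mult_ac)
qed

lemma char_idem_mult_weight: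
  assumes "l \<in> lin_chars S" "\<And>s. s \<in> S \<Longrightarrow> s * x = sc (l s) x"
  shows "char_idem S l * x = x"
proof -
  have "char_idem S l * x = sc (1 / of_nat (card S)) (\<Sum>s\<in>S. sc (inverse (l s)) (sc (l s) x))"
    using assms(2) by (simp add: char_idem_def sum_distrib_right)
  also have "(\<Sum>s\<in>S. sc (inverse (l s)) (sc (l s) x)) = (\<Sum>s\<in>S. x)"
    using assms(1) by (intro sum.cong) (auto simp: lin_chars_def)
  also have "\<dots> = sc (of_nat (card S)) x"
    by (simp add: fsm_eqI ent_sum)
  finally show ?thesis using card_pos by simp
qed

lemma char_idem_idem: "l \<in> lin_chars S \<Longrightarrow> char_idem S l * char_idem S l = char_idem S l"
  by (rule char_idem_mult_weight) (auto simp: mult_char_idem)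

lemma char_idem_orthogonal:
  assumes "l \<in> lin_chars S" "m \<in> lin_chars S" "l \<noteq> m"
  shows "char_idem S l * char_idem S m = 0"
proof -
  obtain s where s: "s \<in> S" "l s \<noteq> m s"
    using assms extensionalityI[of l S m] by (auto simp: lin_chars_def)
  have "sc (l s) (char_idem S l * char_idem S m) = char_idem S l * s * char_idem S m"
    using mult_char_idem assms s by simp
  also have "\<dots> = sc (m s) (char_idem S l * char_idem S m)"
    by (simp only: mult.assoc mult_char_idem(1)[OF assms(2) s(1)] sc_mult_right)
  finally show ?thesis using s(2) by (simp only: fsm.scale_cancel_right) simp
qed

text \<open>
  On a joint eigenvector of the left multiplications by \<open>S\<close>, exactly the idempotent of its weight
  acts as the identity and all others act as zero. As these eigenvectors generate \<open>M n\<close>, the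
  sum of the idempotents acts as the identity on all of \<open>M n\<close>.
\<close>

lemma sum_char_idem:
  assumes comm: "\<And>s t. s \<in> S \<Longrightarrow> t \<in> S \<Longrightarrow> s * t = t * s"
  shows "(\<Sum>l\<in>lin_chars S. char_idem S l) = idm n"
proof -
  define I where "I = (\<Sum>l\<in>lin_chars S. char_idem S l)"
  have "M n \<subseteq> {x. I * x = x}"
  proof (rule simultaneous_eigenvectors_generate[of "(*) ` S"])
    show "finite ((*) ` S)" using finite_S by simp
    show "fsm.subspace (M n)" by (auto simp: fsm.subspace_def)
    show "\<exists>k>0. \<forall>x\<in>M n. (D ^^ k) x = x" if "D \<in> (*) ` S" for D
    proof -
      obtain s where s: "s \<in> S" "D = (*) s" using \<open>D \<in> (*) ` S\<close> by auto
      obtain k where k: "k > 0" "((*) s ^^ k) (idm n) = idm n" using finite_order[OF s(1)] .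
      have "(D ^^ k) x = x" if "x \<in> M n" for x
        using funpow_left[OF that s(1), of k] k(2) s(2) that by simp
      thus ?thesis using k(1) by blast
    qed
    show "D (D' x) = D' (D x)" if "D \<in> (*) ` S" "D' \<in> (*) ` S" for D D' x
      using that comm by (auto simp flip: mult.assoc)
    show "x \<in> {x. I * x = x}"
      if x: "x \<in> M n" and eig: "\<And>D. D \<in> (*) ` S \<Longrightarrow> \<exists>c. D x = sc c x" for x
    proof (cases "x = 0")
      case False
      have "\<exists>c. s * x = sc c x" if "s \<in> S" for s using eig[of "(*) s"] that by auto
      then obtain c where c: "\<And>s. s \<in> S \<Longrightarrow> s * x = sc (c s) x" by metis
      define l where "l = restrict c S"
      have l: "s * x = sc (l s) x" if "s \<in> S" for s using c that by (simp add: l_def)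
      have "l s \<noteq> 0" if "s \<in> S" for s
      proof
        assume "l s = 0"
        hence "minv n s * (s * x) = 0" using l[OF that] by simp
        thus False using False that x by simp
      qed
      moreover have "l (s * t) = l s * l t" if "s \<in> S" "t \<in> S" for s t
      proof -
        have "sc (l (s * t)) x = sc (l s * l t) x"
          using l[of "s * t"] l[of s] l[of t] that mult_S
          by (simp add: mult.assoc) (metis mult.commute)
        thus ?thesis using False by (simp only: fsm.scale_cancel_right) simp
      qed
      ultimately have L: "l \<in> lin_chars S" by (auto simp: lin_chars_def l_def)
      have el: "char_idem S l * x = x" by (rule char_idem_mult_weight[OF L l])
      have "char_idem S m * x = (if m = l then x else 0)" if "m \<in> lin_chars S" for m
        using char_idem_orthogonal[OF that L] el by (metis mult.assoc mult_zero_left)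
      hence "I * x = (\<Sum>m\<in>lin_chars S. if m = l then x else 0)"
        by (simp add: I_def sum_distrib_right)
      thus ?thesis using L finite_lin_chars by simp
    qed simp
  qed (auto simp: algebra_simps)
  hence "I * idm n = idm n" using idm_M[of n] by blast
  thus ?thesis by (simp add: I_def)
qed

lemma eq_sum_char_idem:
  assumes "\<And>s t. s \<in> S \<Longrightarrow> t \<in> S \<Longrightarrow> s * t = t * s" "s \<in> S"
  shows "s = (\<Sum>l\<in>lin_chars S. sc (l s) (char_idem S l))"
proof -
  have "s = s * (\<Sum>l\<in>lin_chars S. char_idem S l)"
    using sum_char_idem assms by simp
  also have "\<dots> = (\<Sum>l\<in>lin_chars S. sc (l s) (char_idem S l))"
    using mult_char_idem assms(2) by (simp add: sum_distrib_left)
  finally show ?thesis .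
qed

text \<open>
  \<open>s\<close> is a combination of idempotents whose coefficients are roots of unity, and the traces of the
  idempotents are real.
\<close>

lemma tr_inv:
  assumes comm: "\<And>s t. s \<in> S \<Longrightarrow> t \<in> S \<Longrightarrow> s * t = t * s" and s: "s \<in> S"
  shows "tr (minv n s) = cnj (tr s)"
proof -
  have tr: "tr t = (\<Sum>l\<in>lin_chars S. l t * tr (char_idem S l))" if "t \<in> S" for t
    by (subst eq_sum_char_idem[OF comm that]) (simp_all add: tr_sum)
  have "l (minv n s) = cnj (l s)" if l: "l \<in> lin_chars S" for l
  proof -
    have "l (minv n s) * l s = l (minv n s * s)"
      using l s inv_facts(1)[OF s] by (auto simp: lin_chars_def)
    also have "\<dots> = 1"
      using lin_char_root_of_unity[OF l _ one_S, of 1] s by (simp add: inv_facts)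
    also have "1 = cnj (l s) * l s"
      using norm_lin_char[OF l s] complex_norm_square[of "l s"] by (simp add: mult.commute)
    finally show ?thesis using norm_lin_char[OF l s] by auto
  qed
  moreover have "cnj (tr (char_idem S l)) = tr (char_idem S l)" if "l \<in> lin_chars S" for l
    using tr_idempotent[OF char_idem_M char_idem_idem[OF that]] by (auto elim: Nats_cases)
  ultimately show ?thesis
    using tr[OF s] tr[OF inv_facts(1)[OF s]] by simp
qed

lemma conj_char_idem:
  assumes "u \<in> M n" "v \<in> M n" "u * v = idm n" "v * u = idm n"
    and stable: "\<And>s. s \<in> S \<Longrightarrow> u * s * v \<in> S" "\<And>s. s \<in> S \<Longrightarrow> v * s * u \<in> S"
    and l: "l \<in> lin_chars S"
  shows "\<exists>m\<in>lin_chars S. u * char_idem S l * v = char_idem S m"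
proof -
  define m where "m = (\<lambda>s\<in>S. l (v * s * u))"
  have vux: "v * (u * x) = x" "u * (v * x) = x" if "x \<in> M n" for x
    using assms that by (simp_all flip: mult.assoc)
  have "(v * s * u) * (v * t * u) = v * (s * t) * u" if "s \<in> S" "t \<in> S" for s t
    using that assms by (simp add: mult.assoc vux)
  hence m: "m \<in> lin_chars S"
    using l stable mult_S by (auto simp: lin_chars_def m_def) metis
  have "bij_betw (\<lambda>s. u * s * v) S S"
    by (rule bij_betwI[of _ _ _ "\<lambda>s. v * s * u"]) (use stable assms vux in \<open>auto simp: mult.assoc\<close>)
  hence "(\<Sum>s\<in>S. sc (inverse (m s)) s) = (\<Sum>s\<in>S. sc (inverse (m (u * s * v))) (u * s * v))"
    by (rule sum.reindex_bij_betw[symmetric])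
  also have "\<dots> = (\<Sum>s\<in>S. sc (inverse (l s)) (u * s * v))"
    using stable assms vux by (intro sum.cong) (auto simp: m_def mult.assoc)
  finally have "u * char_idem S l * v = char_idem S m"
    by (simp add: char_idem_def sum_distrib_left sum_distrib_right)
  thus ?thesis using m by blast
qed

end

section \<open>Primitive representations\<close>

locale fsm_rep = group G for G (structure) +
  fixes n :: nat and R :: "'a \<Rightarrow> fsm"
  assumes finite_G: "finite (carrier G)" and n_pos: "n > 0"
    and R_M [simp]: "g \<in> carrier G \<Longrightarrow> R g \<in> M n"
    and R_mult: "g \<in> carrier G \<Longrightarrow> h \<in> carrier G \<Longrightarrow> R (g \<otimes> h) = R g * R h"
    and R_one: "R \<one> = idm n"
begin

lemma R_inv:
  assumes "g \<in> carrier G"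
  shows "R g * R (inv g) = idm n" "R (inv g) * R g = idm n"
  using assms by (simp_all add: R_one flip: R_mult)

lemma R_cancel [simp]:
  assumes "g \<in> carrier G" "x \<in> M n"
  shows "R g * (R (inv g) * x) = x" "R (inv g) * (R g * x) = x"
  using assms by (simp_all add: R_inv flip: mult.assoc)

definition cj :: "'a \<Rightarrow> fsm \<Rightarrow> fsm" where "cj g x = R g * x * R (inv g)"

lemma cj_M [simp]: "g \<in> carrier G \<Longrightarrow> x \<in> M n \<Longrightarrow> cj g x \<in> M n"
  by (simp add: cj_def)

lemma cj_one [simp]: "x \<in> M n \<Longrightarrow> cj \<one> x = x"
  by (simp add: cj_def R_one)

lemma cj_comp:
  "g \<in> carrier G \<Longrightarrow> h \<in> carrier G \<Longrightarrow> cj (g \<otimes> h) x = cj g (cj h x)"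
  by (simp add: cj_def R_mult inv_mult_group mult.assoc)

lemma cj_cancel [simp]:
  "g \<in> carrier G \<Longrightarrow> x \<in> M n \<Longrightarrow> cj g (cj (inv g) x) = x"
  "g \<in> carrier G \<Longrightarrow> x \<in> M n \<Longrightarrow> cj (inv g) (cj g x) = x"
  by (simp_all flip: cj_comp)

lemma cj_mult: "g \<in> carrier G \<Longrightarrow> x \<in> M n \<Longrightarrow> y \<in> M n \<Longrightarrow> cj g (x * y) = cj g x * cj g y"
  by (simp add: cj_def mult.assoc)

lemma cj_idm [simp]: "g \<in> carrier G \<Longrightarrow> cj g (idm n) = idm n"
  by (simp add: cj_def R_inv)

lemma cj_sum: "cj g (sum f A) = (\<Sum>a\<in>A. cj g (f a))"
  by (simp add: cj_def sum_distrib_left sum_distrib_right)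

lemma cj_sc: "cj g (sc c x) = sc c (cj g x)"
  by (simp add: cj_def)

lemma cj_inj: "g \<in> carrier G \<Longrightarrow> x \<in> M n \<Longrightarrow> y \<in> M n \<Longrightarrow> cj g x = cj g y \<Longrightarrow> x = y"
  by (metis cj_cancel(2))

lemma cj_eq_iff_commute:
  assumes "g \<in> carrier G" "x \<in> M n" "y \<in> M n"
  shows "cj g x = y \<longleftrightarrow> R g * x = y * R g"
proof
  assume "cj g x = y"
  thus "R g * x = y * R g" using assms by (auto simp: cj_def mult.assoc R_inv)
next
  assume "R g * x = y * R g"
  hence "cj g x = y * R g * R (inv g)" by (simp add: cj_def)
  thus "cj g x = y" using assms by (simp add: mult.assoc R_inv)
qed

lemma tr_cj: "g \<in> carrier G \<Longrightarrow> x \<in> M n \<Longrightarrow> tr (cj g x) = tr x"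
  using tr_commute[of "R g * x" "R (inv g)"] by (simp add: cj_def)

lemma fdet_cj: "g \<in> carrier G \<Longrightarrow> x \<in> M n \<Longrightarrow> fdet n (cj g x) = fdet n x"
proof -
  assume g: "g \<in> carrier G" and x: "x \<in> M n"
  have "fdet n (R g) * fdet n (R (inv g)) = 1"
    using fdet_mult[of "R g" n "R (inv g)"] g by (simp add: R_inv)
  moreover have "fdet n (cj g x) = (fdet n (R g) * fdet n (R (inv g))) * fdet n x"
    using g x by (simp add: cj_def fdet_mult)
  ultimately show "fdet n (cj g x) = fdet n x" by simp
qed

end

text \<open>
  Irreducibility is needed in two forms only: no idempotent other than \<open>0\<close> and \<open>1\<close> has an
  invariant image, and Schur's lemma holds.
\<close>

locale irr_rep = fsm_rep +
  assumes irr: "e \<in> M n \<Longrightarrow> e * e = e \<Longrightarrow> e \<noteq> 0 \<Longrightarrow>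
      (\<And>g. g \<in> carrier G \<Longrightarrow> R g * e = e * R g * e) \<Longrightarrow> e = idm n"
    and schur: "z \<in> M n \<Longrightarrow> (\<And>g. g \<in> carrier G \<Longrightarrow> R g * z = z * R g) \<Longrightarrow>
      \<exists>c. z = sc c (idm n)"
begin

text \<open>
  This is a system of imprimitivity: the idempotents are the projections to the summands of a
  decomposition of the underlying space that \<open>G\<close> permutes.
\<close>

definition idempotent_system :: "fsm set \<Rightarrow> bool"
  where "idempotent_system I \<longleftrightarrow> finite I \<and> I \<subseteq> M n \<and> (\<forall>e\<in>I. e * e = e \<and> e \<noteq> 0) \<and>
    (\<forall>e\<in>I. \<forall>f\<in>I. e \<noteq> f \<longrightarrow> e * f = 0) \<and> (\<forall>g\<in>carrier G. \<forall>e\<in>I. cj g e \<in> I) \<and>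
    (\<Sum>e\<in>I. e) = idm n"

text \<open>
  The sum over an orbit is a nonzero idempotent that commutes with \<open>G\<close>, hence is the identity,
  which leaves no room for a further orbit.
\<close>

lemma idempotent_system_transitive:
  assumes I: "idempotent_system I" and e: "e \<in> I"
  shows "(\<lambda>g. cj g e) ` carrier G = I"
proof -
  define J where "J = (\<lambda>g. cj g e) ` carrier G"
  define s where "s = (\<Sum>a\<in>J. a)"
  have JI: "J \<subseteq> I" and finJ: "finite J" using I e finite_G by (auto simp: idempotent_system_def J_def)
  have IM: "a \<in> M n" if "a \<in> I" for a using I that by (auto simp: idempotent_system_def)
  have as: "a * s = (if a \<in> J then a else 0)" if "a \<in> I" for a
  proof -
    have "a * s = (\<Sum>b\<in>J. if b = a then a else 0)"
      unfolding s_def sum_distrib_left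
      using I JI that by (intro sum.cong) (auto simp: idempotent_system_def)
    thus ?thesis using finJ by simp
  qed
  have sM: "s \<in> M n" unfolding s_def using IM JI by (intro Mat_sum) auto
  have "e \<in> J" unfolding J_def using IM[OF e] by (auto intro!: image_eqI[of _ _ \<one>])
  hence "e * s = e" using as e by auto
  hence "s \<noteq> 0" using I e by (auto simp: idempotent_system_def)
  moreover have ss: "s * s = s"
  proof -
    have "s * s = (\<Sum>a\<in>J. a * s)" by (simp add: s_def sum_distrib_right)
    also have "\<dots> = s" unfolding s_def by (rule sum.cong) (use as JI s_def in auto)
    finally show ?thesis .
  qed
  moreover have "R g * s = s * R g * s" if g: "g \<in> carrier G" for g
  proof -
    have cjJ: "cj h a \<in> J" if "h \<in> carrier G" "a \<in> J" for h a
      using that by (auto simp: J_def simp flip: cj_comp)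
    have "bij_betw (cj g) J J"
      by (rule bij_betwI[of _ _ _ "cj (inv g)"]) (use g cjJ IM JI in auto)
    hence "(\<Sum>a\<in>J. cj g a) = s" unfolding s_def by (rule sum.reindex_bij_betw)
    hence "cj g s = s" unfolding s_def cj_sum by simp
    hence "R g * s = s * R g" using cj_eq_iff_commute g sM by simp
    thus ?thesis by (metis ss mult.assoc)
  qed
  ultimately have s: "s = idm n" using irr sM by blast
  have "a \<in> J" if "a \<in> I" for a
  proof (rule ccontr)
    assume "a \<notin> J"
    hence "a = 0" using as[OF that] s IM[OF that] by simp
    thus False using I that by (auto simp: idempotent_system_def)
  qed
  thus ?thesis using JI by (auto simp: J_def)
qed

text \<open>
  Here \<open>H\<close> is the stabilizer of one of the idempotents \<open>e\<close>, and \<open>\<psi>(h)\<close> is the trace of \<open>e \<rho>(h)\<close>.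
  Both sides of the formula for the induced character are the sum of \<open>tr(a \<rho>(g))\<close> over those
  members \<open>a\<close> of the system that \<open>g\<close> fixes. On the left, the members moved by \<open>g\<close> contribute zero
  by orthogonality. On the right, each member arises from as many elements of \<open>G\<close> as \<open>H\<close> has.
\<close>

theorem idempotent_system_induced:
  assumes I: "idempotent_system I" and nontriv: "I \<noteq> {idm n}"
  shows "\<exists>H \<psi>. subgroup H G \<and> H \<noteq> carrier G \<and> \<psi> \<in> characters (G\<lparr>carrier := H\<rparr>) \<and>
    (\<lambda>g\<in>carrier G. tr (R g)) = induced_character G H \<psi>"
proof -
  have "I \<noteq> {}" using I idm_nonzero[OF n_pos] by (auto simp: idempotent_system_def)
  then obtain e where e: "e \<in> I" by auto
  have orb: "(\<lambda>g. cj g e) ` carrier G = I" by (rule idempotent_system_transitive[OF I e])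
  have eM: "e \<in> M n" and ee: "e * e = e" and e0: "e \<noteq> 0" and finI: "finite I"
    using I e by (auto simp: idempotent_system_def)
  define H where "H = {g \<in> carrier G. cj g e = e}"
  have H: "subgroup H G"
  proof (rule subgroupI)
    show "inv a \<in> H" if "a \<in> H" for a
      using that cj_cancel(2)[of a e] eM by (auto simp: H_def)
    show "a \<otimes> b \<in> H" if "a \<in> H" "b \<in> H" for a b
      using that by (auto simp: H_def cj_comp)
    have "\<one> \<in> H" using eM by (auto simp: H_def)
    thus "H \<noteq> {}" by auto
  qed (auto simp: H_def)
  have HG: "H \<noteq> carrier G"
  proof
    assume "H = carrier G"
    hence "(\<lambda>g. cj g e) ` carrier G = {e}" using eM by (auto simp: H_def intro!: image_eqI[of _ _ \<one>])
    hence "I = {e}" using orb by simp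
    moreover from this I have "e = idm n" by (simp add: idempotent_system_def)
    ultimately show False using nontriv by simp
  qed
  obtain r P Q where PQ: "P \<in> Mat n r" "Q \<in> Mat r n" "P * Q = e" "Q * P = idm r"
    using idempotent_factorization[OF eM ee] by metis
  have "r > 0"
  proof (rule ccontr)
    assume "\<not> r > 0"
    hence "P = 0" using MatD[OF PQ(1)] by (intro fsm_eqI) auto
    thus False using PQ(3) e0 by simp
  qed
  have eP: "e * P = P" using PQ mult_idm[OF PQ(1)] by (metis mult.assoc)
  have QRP: "Q * R h * P \<in> Mat r r" if "h \<in> carrier G" for h
    using Mat_mult[OF Mat_mult[OF PQ(2) R_M[OF that]] PQ(1)] .
  define \<sigma> where "\<sigma> h = to_mat r r (Q * R h * P)" for h
  have \<sigma>_mult: "\<sigma> (h \<otimes> k) = \<sigma> h * \<sigma> k" if "h \<in> H" "k \<in> H" for h k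
  proof -
    have hk: "h \<in> carrier G" "k \<in> carrier G" "cj k e = e" using that by (auto simp: H_def)
    have ke: "R k * e = e * R k" using hk cj_eq_iff_commute eM by simp
    have "Q * R h * P * (Q * R k * P) = Q * R h * (e * R k) * P"
      by (simp add: mult.assoc flip: PQ(3))
    also have "\<dots> = Q * R h * R k * (e * P)" by (simp only: ke[symmetric] mult.assoc)
    finally have "Q * R (h \<otimes> k) * P = Q * R h * P * (Q * R k * P)"
      using hk by (simp add: eP R_mult mult.assoc)
    thus ?thesis using to_mat_mult[OF QRP[OF hk(1)], of r "Q * R k * P"] by (simp add: \<sigma>_def)
  qed
  have \<sigma>_one: "\<sigma> \<one> = 1\<^sub>m r"
    using PQ(4) mult_idm[OF PQ(2)] by (simp add: \<sigma>_def R_one)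
  have rep: "mat_rep (G\<lparr>carrier := H\<rparr>) r \<sigma>"
    unfolding mat_rep_def
  proof (intro conjI homI)
    fix h assume "h \<in> carrier (G\<lparr>carrier := H\<rparr>)"
    hence h: "h \<in> H" by simp
    hence h': "inv h \<in> H" "h \<in> carrier G" using subgroup.m_inv_closed[OF H] by (auto simp: H_def)
    have "\<sigma> h * \<sigma> (inv h) = 1\<^sub>m r" "\<sigma> (inv h) * \<sigma> h = 1\<^sub>m r"
      using \<sigma>_mult[OF h h'(1)] \<sigma>_mult[OF h'(1) h] \<sigma>_one h' by simp_all
    thus "\<sigma> h \<in> carrier (GL r)"
      by (auto simp: GL_def units_of_def Units_def ring_mat_def \<sigma>_def)
  qed (use \<open>r > 0\<close> \<sigma>_mult in \<open>auto simp: GL_def units_of_def ring_mat_def\<close>)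
  define \<psi> where "\<psi> = afforded_character (G\<lparr>carrier := H\<rparr>) \<sigma>"
  have \<psi>: "\<psi> h = tr (e * R h)" if "h \<in> H" for h
  proof -
    have "h \<in> carrier G" using that by (simp add: H_def)
    hence "mat_trace (\<sigma> h) = tr (Q * R h * P)" unfolding \<sigma>_def by (rule mat_trace_to_mat[OF QRP])
    also have "\<dots> = tr (P * Q * R h)" using tr_commute[of "Q * R h" P] by (simp add: mult.assoc)
    finally show ?thesis using that by (simp add: \<psi>_def afforded_character_def PQ(3))
  qed
  have "tr (R g) = induced_character G H \<psi> g" if g: "g \<in> carrier G" for g
  proof -
    define F where "F a = (if cj g a = a then tr (a * R g) else 0)" for a
    have IM: "a \<in> M n" if "a \<in> I" for a using I that by (auto simp: idempotent_system_def)
    have "tr (a * R g) = F a" if a: "a \<in> I" for a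
    proof (cases "cj g a = a")
      case False
      have ca: "cj g a \<in> I" and "a * cj g a = 0" and aa: "a * a = a"
        using I a g False by (auto simp: idempotent_system_def)
      have "tr (a * R g) = tr (a * (a * R g))" by (simp add: aa flip: mult.assoc)
      also have "\<dots> = tr (a * (R g * a))" using tr_commute[of a "a * R g"] by (simp add: mult.assoc)
      also have "R g * a = cj g a * R g" using cj_eq_iff_commute[of g a "cj g a"] IM a g by simp
      also have "a * (cj g a * R g) = 0" using \<open>a * cj g a = 0\<close> by (simp flip: mult.assoc)
      finally show ?thesis using False by (simp add: F_def)
    qed (simp add: F_def)
    moreover have "tr (R g) = (\<Sum>a\<in>I. tr (a * R g))"
    proof -
      have "R g = (\<Sum>a\<in>I. a) * R g" using I g by (simp add: idempotent_system_def)
      thus ?thesis by (simp add: sum_distrib_right tr_sum[symmetric])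
    qed
    ultimately have trg: "tr (R g) = (\<Sum>a\<in>I. F a)" by simp
    have fibre: "card {x \<in> carrier G. cj x e = a} = card H" if "a \<in> I" for a
    proof -
      obtain y where y: "y \<in> carrier G" "a = cj y e" using \<open>a \<in> I\<close> orb by auto
      have "bij_betw (\<lambda>h. y \<otimes> h) H {x \<in> carrier G. cj x e = a}"
      proof (rule bij_betwI[of _ _ _ "\<lambda>x. inv y \<otimes> x"])
        show "(\<lambda>h. y \<otimes> h) \<in> H \<rightarrow> {x \<in> carrier G. cj x e = a}"
          using y by (auto simp: H_def cj_comp)
        show "(\<lambda>x. inv y \<otimes> x) \<in> {x \<in> carrier G. cj x e = a} \<rightarrow> H"
          using y eM by (auto simp: H_def cj_comp)
      qed (use y in \<open>auto simp: H_def simp flip: m_assoc\<close>)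
      thus ?thesis by (simp add: bij_betw_same_card)
    qed
    have "(\<Sum>x\<in>carrier G. let y = x \<otimes> g \<otimes> inv x in if y \<in> H then \<psi> y else 0)
      = (\<Sum>x\<in>carrier G. F (cj (inv x) e))"
    proof (rule sum.cong)
      fix x assume x: "x \<in> carrier G"
      define a where "a = cj (inv x) e"
      have e_a: "e = cj x a" using x eM by (simp add: a_def)
      have aM: "a \<in> M n" using x eM by (simp add: a_def)
      have "cj (x \<otimes> g \<otimes> inv x) e = cj x (cj g a)" using x g by (simp add: cj_comp a_def)
      hence "x \<otimes> g \<otimes> inv x \<in> H \<longleftrightarrow> cj x (cj g a) = cj x a"
        using x g e_a by (simp add: H_def)
      also have "\<dots> \<longleftrightarrow> cj g a = a" using cj_inj[of x "cj g a" a] x g aM by auto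
      finally have iff: "x \<otimes> g \<otimes> inv x \<in> H \<longleftrightarrow> cj g a = a" .
      have "e * R (x \<otimes> g \<otimes> inv x) = cj x (a * R g)"
        using x g aM by (simp add: e_a R_mult cj_def mult.assoc)
      hence "tr (e * R (x \<otimes> g \<otimes> inv x)) = tr (a * R g)"
        using x g aM by (simp add: tr_cj)
      thus "(let y = x \<otimes> g \<otimes> inv x in if y \<in> H then \<psi> y else 0) = F (cj (inv x) e)"
        using iff \<psi> by (auto simp: F_def Let_def a_def)
    qed simp
    also have "\<dots> = (\<Sum>x\<in>carrier G. F (cj x e))"
      by (rule sum.reindex_bij_betw, rule bij_betwI[of _ _ _ "\<lambda>x. inv x"]) auto
    also have "\<dots> = (\<Sum>a\<in>I. \<Sum>x | x \<in> carrier G \<and> cj x e = a. F (cj x e))"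
      using sum.image_gen[OF finite_G, of "\<lambda>x. F (cj x e)" "\<lambda>x. cj x e"] orb by simp
    also have "\<dots> = (\<Sum>a\<in>I. of_nat (card H) * F a)"
      by (rule sum.cong) (simp_all add: fibre)
    also have "\<dots> = of_nat (card H) * tr (R g)" by (simp add: trg sum_distrib_left)
    finally have "(\<Sum>x\<in>carrier G. let y = x \<otimes> g \<otimes> inv x in if y \<in> H then \<psi> y else 0)
      = of_nat (card H) * tr (R g)" .
    moreover have "card H \<noteq> 0"
      using subgroup.one_closed[OF H] finite_G by (auto simp: H_def card_eq_0_iff)
    ultimately show ?thesis using g by (simp add: induced_character_def)
  qed
  hence "(\<lambda>g\<in>carrier G. tr (R g)) = induced_character G H \<psi>"
    by (auto simp: induced_character_def fun_eq_iff)
  moreover have "\<psi> \<in> characters (G\<lparr>carrier := H\<rparr>)"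
    using rep by (auto simp: characters_def \<psi>_def)
  ultimately show ?thesis using H HG by blast
qed

end

locale prim_rep = irr_rep +
  assumes prim: "idempotent_system I \<Longrightarrow> I = {idm n}"
begin

text \<open>
  The nonzero idempotents of the linear characters of \<open>S\<close> form a system of imprimitivity. Hence
  there is only one of them, and all of \<open>S\<close> acts through the corresponding character.
\<close>

lemma abelian_normalized_scalar:
  assumes "mgrp n S" and comm: "\<And>s t. s \<in> S \<Longrightarrow> t \<in> S \<Longrightarrow> s * t = t * s"
    and stable: "\<And>g s. g \<in> carrier G \<Longrightarrow> s \<in> S \<Longrightarrow> cj g s \<in> S"
    and s: "s \<in> S"
  shows "\<exists>c. s = sc c (idm n)"
proof -
  interpret mgrp n S by fact
  define I where "I = char_idem S ` lin_chars S - {0}"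
  have cj_I: "cj g (char_idem S l) \<in> char_idem S ` lin_chars S"
    if "g \<in> carrier G" "l \<in> lin_chars S" for g l
  proof -
    have "\<exists>m\<in>lin_chars S. R g * char_idem S l * R (inv g) = char_idem S m"
    proof (rule conj_char_idem)
      show "R g * s * R (inv g) \<in> S" if "s \<in> S" for s
        using stable[OF \<open>g \<in> carrier G\<close> that] by (simp add: cj_def)
      show "R (inv g) * s * R g \<in> S" if "s \<in> S" for s
        using stable[of "inv g" s] \<open>g \<in> carrier G\<close> that by (simp add: cj_def)
    qed (use that in \<open>auto simp: R_inv\<close>)
    thus ?thesis by (auto simp: cj_def)
  qed
  have inj: "l = m"
    if "l \<in> lin_chars S" "m \<in> lin_chars S" "char_idem S l = char_idem S m" "char_idem S l \<noteq> 0"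
    for l m
    using char_idem_orthogonal[OF that(1,2)] char_idem_idem that by metis
  define L where "L = {l \<in> lin_chars S. char_idem S l \<noteq> 0}"
  have IL: "I = char_idem S ` L" by (auto simp: I_def L_def)
  have sumI: "(\<Sum>e\<in>I. e) = (\<Sum>l\<in>L. char_idem S l)"
    unfolding IL by (subst sum.reindex) (auto simp: inj_on_def L_def intro: inj)
  also have "\<dots> = (\<Sum>l\<in>lin_chars S. char_idem S l)"
    using finite_lin_chars by (intro sum.mono_neutral_left) (auto simp: L_def)
  finally have "(\<Sum>e\<in>I. e) = idm n" using sum_char_idem[OF comm] by simp
  moreover have "cj g e \<in> I" if "g \<in> carrier G" "e \<in> I" for g e
  proof -
    have "cj g e \<noteq> 0"
    proof
      assume "cj g e = 0"
      hence "cj (inv g) (cj g e) = 0" by (simp add: cj_def)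
      thus False using that by (auto simp: I_def)
    qed
    thus ?thesis using that cj_I by (auto simp: I_def)
  qed
  moreover have "e * f = 0" if "e \<in> I" "f \<in> I" "e \<noteq> f" for e f
    using that char_idem_orthogonal by (auto simp: I_def)
  moreover have "e * e = e" if "e \<in> I" for e
    using that char_idem_idem by (auto simp: I_def)
  ultimately have "idempotent_system I"
    unfolding idempotent_system_def using finite_lin_chars by (auto simp: I_def)
  hence I1: "char_idem S ` L = {idm n}" using prim IL by blast
  then obtain l where l: "l \<in> L" "char_idem S l = idm n" by (metis imageE insertI1)
  hence "s * idm n = sc (l s) (idm n)" using mult_char_idem(1)[of l s] s by (auto simp: L_def)
  thus ?thesis using s by auto
qed

end

section \<open>Normalized groups with scalar commutators\<close>

lemma mult_commute_imp_mult_commute: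
  fixes x :: fsm
  assumes "e * x = x * e" "e * y = y * e"
  shows "e * (x * y) = x * y * e"
proof -
  have "e * (x * y) = (e * x) * y" by (simp only: mult.assoc)
  also have "\<dots> = x * (e * y)" by (simp only: assms(1) mult.assoc)
  finally show ?thesis by (simp only: assms(2) mult.assoc)
qed

context fsm_rep
begin

definition centr :: "fsm set \<Rightarrow> fsm set"
  where "centr E = {y \<in> M n. \<forall>e\<in>E. e * y = y * e}"

text \<open>
  The order of this subgroup measures how far the enlargement of \<open>E\<close> has proceeded.
\<close>

definition act_ker :: "fsm set \<Rightarrow> 'a set"
  where "act_ker E = {g \<in> carrier G. \<forall>y\<in>centr E. cj g y = y}"

lemma centr_M: "y \<in> centr E \<Longrightarrow> y \<in> M n" by (simp add: centr_def)

lemma centr_mult: "x \<in> centr E \<Longrightarrow> y \<in> centr E \<Longrightarrow> x * y \<in> centr E"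
  by (auto simp: centr_def intro: mult_commute_imp_mult_commute)

lemma centr_sc: "x \<in> centr E \<Longrightarrow> sc c x \<in> centr E"
  by (auto simp: centr_def)

end

text \<open>
  Like a Heisenberg group, such a group is abelian modulo scalars. What matters is \<open>E\<close> modulo
  scalars, but for a finite group of matrices the sums over representatives can be replaced by
  sums over \<open>E\<close> itself.
\<close>

locale heisenberg = prim_rep G n R + E: mgrp n E
  for G (structure) and n and R and E +
  assumes stable: "g \<in> carrier G \<Longrightarrow> e \<in> E \<Longrightarrow> cj g e \<in> E"
    and commutator: "e \<in> E \<Longrightarrow> f \<in> E \<Longrightarrow> \<exists>c. e * f = sc c (f * e)"
begin

abbreviation "B \<equiv> centr E"

lemma B_commute: "y \<in> B \<Longrightarrow> e \<in> E \<Longrightarrow> e * y = y * e" by (simp add: centr_def)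

lemma B_commute_inv: "y \<in> B \<Longrightarrow> e \<in> E \<Longrightarrow> minv n e * y = y * minv n e"
  by (intro B_commute E.inv_facts(1))

text \<open>
  The centre of \<open>E\<close> is abelian and normalized by \<open>G\<close>.
\<close>

lemma center_scalar:
  assumes "e \<in> E" "\<And>f. f \<in> E \<Longrightarrow> e * f = f * e"
  shows "\<exists>c. e = sc c (idm n)"
proof -
  define Z where "Z = {e \<in> E. \<forall>f\<in>E. e * f = f * e}"
  have ZI: "s \<in> Z" if "s \<in> E" "\<And>f. f \<in> E \<Longrightarrow> s * f = f * s" for s
    using that unfolding Z_def by blast
  have ZE: "s \<in> E" if "s \<in> Z" for s using that unfolding Z_def by blast
  have ZC: "s * f = f * s" if "s \<in> Z" "f \<in> E" for s f using that unfolding Z_def by blast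
  have "mgrp n Z"
  proof
    show "finite Z" using E.finite_S by (simp add: Z_def)
    show "Z \<subseteq> M n" using E.S_M ZE by blast
    show "idm n \<in> Z" using E.one_S by (intro ZI) simp_all
    show "s * t \<in> Z" if "s \<in> Z" "t \<in> Z" for s t
    proof (rule ZI)
      show "s * t * f = f * (s * t)" if "f \<in> E" for f
        by (rule mult_commute_imp_mult_commute[symmetric]) (use ZC \<open>s \<in> Z\<close> \<open>t \<in> Z\<close> that in metis)+
    qed (use that ZE E.mult_S in blast)
    show "\<exists>t\<in>Z. s * t = idm n \<and> t * s = idm n" if s: "s \<in> Z" for s
    proof
      have sE: "s \<in> E" using s by (rule ZE)
      show "minv n s \<in> Z"
      proof (rule ZI)
        fix f assume f: "f \<in> E"
        have "minv n s * f = minv n s * (f * s) * minv n s"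
          using sE f by (simp add: mult.assoc E.inv_facts)
        also have "f * s = s * f" using ZC[OF s f] by simp
        also have "minv n s * (s * f) * minv n s = f * minv n s" using sE f by simp
        finally show "minv n s * f = f * minv n s" .
      qed (rule E.inv_facts(1)[OF sE])
      show "s * minv n s = idm n \<and> minv n s * s = idm n" using E.inv_facts[OF sE] by auto
    qed
  qed
  moreover have "cj g s \<in> Z" if g: "g \<in> carrier G" and s: "s \<in> Z" for g s
  proof (rule ZI)
    have sE: "s \<in> E" using s by (rule ZE)
    show "cj g s \<in> E" using stable[OF g sE] .
    fix f assume f: "f \<in> E"
    have f': "cj (inv g) f \<in> E" using stable g f by simp
    have "cj g s * f = cj g (s * cj (inv g) f)" using g f sE by (simp add: cj_mult)
    also have "s * cj (inv g) f = cj (inv g) f * s" by (rule ZC[OF s f'])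
    also have "cj g \<dots> = f * cj g s" using g f sE by (simp add: cj_mult)
    finally show "cj g s * f = f * cj g s" .
  qed
  moreover have "e \<in> Z" using assms by (rule ZI)
  ultimately show ?thesis
    using ZC ZE by (intro abelian_normalized_scalar[of Z e]) blast+
qed

lemma cj_B:
  assumes g: "g \<in> carrier G" and y: "y \<in> B"
  shows "cj g y \<in> B"
proof -
  have yM: "y \<in> M n" using y by (rule centr_M)
  have "f * cj g y = cj g y * f" if f: "f \<in> E" for f
  proof -
    have f': "cj (inv g) f \<in> E" using stable g f by simp
    have "f * cj g y = cj g (cj (inv g) f * y)" using g f yM by (simp add: cj_mult)
    also have "cj (inv g) f * y = y * cj (inv g) f" using B_commute[OF y f'] .
    also have "cj g \<dots> = cj g y * f" using g f yM by (simp add: cj_mult)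
    finally show ?thesis .
  qed
  thus ?thesis using g yM by (auto simp: centr_def)
qed

definition conj_sum :: "fsm \<Rightarrow> fsm" where "conj_sum X = (\<Sum>f\<in>E. f * X * minv n f)"

lemma conj_sum_in_B: assumes X: "X \<in> M n" shows "conj_sum X \<in> B"
proof -
  have "e * conj_sum X = conj_sum X * e" if e: "e \<in> E" for e
  proof -
    have "conj_sum X * e = (\<Sum>f\<in>E. (e * f) * X * minv n (e * f) * e)"
      unfolding conj_sum_def sum_distrib_right by (rule E.sum_left[OF e, symmetric])
    also have "\<dots> = (\<Sum>f\<in>E. e * (f * X * minv n f))"
      using e X by (intro sum.cong) (auto simp: mult.assoc E.inv_mult E.inv_facts)
    finally show ?thesis by (simp add: conj_sum_def sum_distrib_left)
  qed
  thus ?thesis using X by (auto simp: centr_def conj_sum_def)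
qed

lemma conj_sum_mult_right: "y \<in> B \<Longrightarrow> conj_sum (X * y) = conj_sum X * y"
proof -
  assume y: "y \<in> B"
  have "f * (X * y) * minv n f = f * X * minv n f * y" if "f \<in> E" for f
    using B_commute_inv[OF y that] by (simp add: mult.assoc)
  thus ?thesis by (simp add: conj_sum_def sum_distrib_right)
qed

lemma conj_sum_mult_left: "y \<in> B \<Longrightarrow> conj_sum (y * X) = y * conj_sum X"
proof -
  assume y: "y \<in> B"
  have "f * (y * X) * minv n f = y * (f * X * minv n f)" if "f \<in> E" for f
    using B_commute[OF y that] by (simp flip: mult.assoc)
  thus ?thesis by (simp add: conj_sum_def sum_distrib_left)
qed

definition scalars :: "fsm set" where "scalars = {f \<in> E. \<exists>c. f = sc c (idm n)}"

text \<open>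
  This is the factor by which the expansion below overcounts: every coset of the scalars occurs as
  often as there are scalars in \<open>E\<close>, and \<open>conj_sum\<close> is a sum rather than an average.
\<close>

definition \<kappa> :: complex where "\<kappa> = of_nat (card E * card scalars)"

lemma \<kappa>_nonzero: "\<kappa> \<noteq> 0"
proof -
  have "idm n = sc 1 (idm n)" by simp
  hence "idm n \<in> scalars" using E.one_S unfolding scalars_def by blast
  moreover have "finite scalars" using E.finite_S by (simp add: scalars_def)
  ultimately show ?thesis using E.card_pos by (auto simp: \<kappa>_def)
qed

text \<open>
  The conjugates of \<open>f\<close> are scalar multiples of \<open>f\<close>, and their sum is invariant under
  conjugation. So either the sum vanishes or \<open>f\<close> itself is central.
\<close>

lemma sum_conjugates:
  assumes f: "f \<in> E"
  shows "(\<Sum>e\<in>E. e * f * minv n e) = (if f \<in> scalars then sc (of_nat (card E)) f else 0)"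
proof (cases "f \<in> scalars")
  case True
  hence "e * f * minv n e = f" if "e \<in> E" for e
    using that by (auto simp: scalars_def E.inv_facts)
  moreover have "(\<Sum>e\<in>E. f) = sc (of_nat (card E)) f" by (simp add: fsm_eqI ent_sum)
  ultimately show ?thesis using True by simp
next
  case False
  have "\<forall>e\<in>E. \<exists>c. e * f = sc c (f * e)" using commutator f by blast
  then obtain c where c: "\<And>e. e \<in> E \<Longrightarrow> e * f = sc (c e) (f * e)" by metis
  have conj: "e * f * minv n e = sc (c e) f" if "e \<in> E" for e
    using that f by (simp add: c mult.assoc E.inv_facts)
  define s where "s = (\<Sum>e\<in>E. e * f * minv n e)"
  have s: "s = sc (sum c E) f" by (simp add: s_def conj fsm.scale_sum_left)
  have "sum c E = 0"
  proof (rule ccontr)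
    assume nz: "sum c E \<noteq> 0"
    have "t * f = f * t" if t: "t \<in> E" for t
    proof -
      have "s * t = (\<Sum>e\<in>E. (t * e) * f * minv n (t * e) * t)"
        unfolding s_def sum_distrib_right by (rule E.sum_left[OF t, symmetric])
      also have "\<dots> = (\<Sum>e\<in>E. t * (e * f * minv n e))"
        using t f by (intro sum.cong) (auto simp: mult.assoc E.inv_mult E.inv_facts)
      also have "\<dots> = t * s" by (simp add: s_def sum_distrib_left)
      finally have "sc (sum c E) (f * t) = sc (sum c E) (t * f)" by (simp add: s)
      thus ?thesis using nz by (simp only: fsm.scale_cancel_left) simp
    qed
    hence "\<exists>c. f = sc c (idm n)" using center_scalar[OF f] by metis
    thus False using False f by (simp add: scalars_def)
  qed
  thus ?thesis using False s by (simp add: s_def)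
qed

text \<open>
  A matrix is a combination of elements of \<open>E\<close> with coefficients in the centralizer \<open>B\<close>. In other
  words, \<open>M n\<close> is the tensor product of \<open>B\<close> and the span of \<open>E\<close>.
\<close>

lemma expansion:
  assumes X: "X \<in> M n"
  shows "(\<Sum>e\<in>E. e * conj_sum (minv n e * X)) = sc \<kappa> X"
proof -
  have "(\<Sum>e\<in>E. e * conj_sum (minv n e * X)) = (\<Sum>f\<in>E. \<Sum>e\<in>E. e * f * minv n e * (X * minv n f))"
    unfolding conj_sum_def sum_distrib_left by (subst sum.swap) (simp add: mult.assoc)
  also have "\<dots> = (\<Sum>f\<in>E. (\<Sum>e\<in>E. e * f * minv n e) * (X * minv n f))"
    by (simp add: sum_distrib_right)
  also have "\<dots> = (\<Sum>f\<in>E. if f \<in> scalars then sc (of_nat (card E)) X else 0)"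
  proof (rule sum.cong)
    fix f assume f: "f \<in> E"
    have "f * (X * minv n f) = X" if "f \<in> scalars"
    proof -
      obtain c where "f = sc c (idm n)" using \<open>f \<in> scalars\<close> by (auto simp: scalars_def)
      hence "f * (X * minv n f) = X * (f * minv n f)" using X f by simp
      thus ?thesis using X f by (simp add: E.inv_facts)
    qed
    thus "(\<Sum>e\<in>E. e * f * minv n e) * (X * minv n f)
        = (if f \<in> scalars then sc (of_nat (card E)) X else 0)"
      using sum_conjugates[OF f] by simp
  qed simp
  also have "\<dots> = (\<Sum>f\<in>scalars. sc (of_nat (card E)) X)"
    using E.finite_S by (subst sum.inter_filter[symmetric]) (auto simp: scalars_def intro!: sum.cong)
  also have "\<dots> = sc \<kappa> X" by (simp add: fsm_eqI ent_sum \<kappa>_def)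
  finally show ?thesis .
qed

text \<open>
  A central element of \<open>B\<close> commutes with \<open>E\<close> and with \<open>B\<close>, which together generate \<open>M n\<close>.
\<close>

lemma B_center_scalar:
  assumes z: "z \<in> B" and comm: "\<And>y. y \<in> B \<Longrightarrow> z * y = y * z"
  shows "\<exists>c. z = sc c (idm n)"
proof (rule central_scalar[OF n_pos centr_M[OF z]])
  fix X assume X: "X \<in> M n"
  have a: "conj_sum (minv n e * X) \<in> B" if "e \<in> E" for e
    using that X by (intro conj_sum_in_B) auto
  have "z * sc \<kappa> X = (\<Sum>e\<in>E. z * (e * conj_sum (minv n e * X)))"
    unfolding expansion[OF X, symmetric] by (simp add: sum_distrib_left)
  also have "\<dots> = (\<Sum>e\<in>E. e * conj_sum (minv n e * X) * z)"
  proof (rule sum.cong)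
    fix e assume e: "e \<in> E"
    have "z * (e * conj_sum (minv n e * X)) = e * (z * conj_sum (minv n e * X))"
      using B_commute[OF z e] by (simp flip: mult.assoc)
    thus "z * (e * conj_sum (minv n e * X)) = e * conj_sum (minv n e * X) * z"
      using comm[OF a[OF e]] by (simp add: mult.assoc)
  qed simp
  also have "\<dots> = sc \<kappa> X * z"
    unfolding expansion[OF X, symmetric] by (simp add: sum_distrib_right)
  finally have "sc \<kappa> (z * X) = sc \<kappa> (X * z)" by simp
  thus "z * X = X * z" using \<kappa>_nonzero by (simp only: fsm.scale_cancel_left) simp
qed

text \<open>
  The coefficients \<open>b\<^sub>e \<in> B\<close> in the expansion of \<open>\<rho>(k)\<close> all satisfy \<open>b\<^sub>e y = y\<^sup>k b\<^sub>e\<close>, where \<open>y\<^sup>k\<close>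
  is the conjugate of \<open>y\<close> by \<open>\<rho>(k)\<close>, and the coefficients \<open>c\<^sub>f\<close> of the inverse of \<open>\<rho>(k)\<close> satisfy
  the opposite relation. So the products \<open>c\<^sub>f b\<^sub>e\<close> are central in \<open>B\<close>, that is, scalar. They cannot
  all vanish, and a nonvanishing one makes \<open>b\<^sub>e\<close> invertible.
\<close>

lemma inner_on_B:
  assumes k: "k \<in> carrier G"
  obtains b b' where "b \<in> B" "b' \<in> B" "b * b' = idm n" "b' * b = idm n" "fdet n b = 1"
    "\<And>y. y \<in> B \<Longrightarrow> cj k y * b = b * y"
proof -
  define b where "b e = conj_sum (minv n e * R k)" for e
  define c where "c f = conj_sum (minv n f * R (inv k))" for f
  have bB: "b e \<in> B" and cB: "c e \<in> B" if "e \<in> E" for e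
    unfolding b_def c_def using that k by (auto intro!: conj_sum_in_B)
  have b_twist: "b e * y = cj k y * b e" if e: "e \<in> E" and y: "y \<in> B" for e y
  proof -
    have "R k * y = cj k y * R k" using cj_eq_iff_commute[of k y "cj k y"] k centr_M[OF y] by simp
    hence "minv n e * R k * y = cj k y * (minv n e * R k)"
      using B_commute_inv[OF cj_B[OF k y] e] by (simp add: mult.assoc) (simp flip: mult.assoc)
    thus ?thesis
      unfolding b_def conj_sum_mult_right[OF y, symmetric] conj_sum_mult_left[OF cj_B[OF k y], symmetric] by simp
  qed
  have c_twist: "c e * cj k y = y * c e" if e: "e \<in> E" and y: "y \<in> B" for e y
  proof -
    have "R (inv k) * cj k y = y * R (inv k)" using k centr_M[OF y] by (simp add: cj_def mult.assoc)
    hence "minv n e * R (inv k) * cj k y = y * (minv n e * R (inv k))"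
      using B_commute_inv[OF y e] by (simp add: mult.assoc) (simp flip: mult.assoc)
    thus ?thesis
      unfolding c_def conj_sum_mult_right[OF cj_B[OF k y], symmetric] conj_sum_mult_left[OF y, symmetric] by simp
  qed
  have cb: "\<exists>d. c f * b e = sc d (idm n)" if "e \<in> E" "f \<in> E" for e f
  proof (rule B_center_scalar)
    fix y assume y: "y \<in> B"
    have "c f * b e * y = c f * cj k y * b e" using b_twist[OF that(1) y] by (simp add: mult.assoc)
    thus "c f * b e * y = y * (c f * b e)" using c_twist[OF that(2) y] by (simp add: mult.assoc)
  qed (use bB cB that centr_mult in auto)
  \<comment> \<open>The product of the two expansions is a nonzero multiple of the identity.\<close>
  have "\<exists>e\<in>E. \<exists>f\<in>E. c f * b e \<noteq> 0"
  proof (rule ccontr)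
    assume none: "\<not> ?thesis"
    have "sc (\<kappa> * \<kappa>) (idm n) = sc \<kappa> (R (inv k)) * sc \<kappa> (R k)"
      using k by (simp add: R_inv)
    also have "\<dots> = (\<Sum>f\<in>E. f * c f) * (\<Sum>e\<in>E. e * b e)"
      using expansion[of "R k"] expansion[of "R (inv k)"] k by (simp add: b_def c_def)
    also have "\<dots> = (\<Sum>f\<in>E. \<Sum>e\<in>E. (f * c f) * (e * b e))" by (rule sum_product)
    also have "\<dots> = (\<Sum>f\<in>E. \<Sum>e\<in>E. 0)"
    proof (intro sum.cong refl)
      fix e f assume ef: "e \<in> E" "f \<in> E"
      have "f * c f * (e * b e) = f * (c f * e) * b e" by (simp add: mult.assoc)
      also have "c f * e = e * c f" using B_commute[OF cB[OF ef(2)] ef(1)] by simp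
      also have "f * (e * c f) * b e = f * e * (c f * b e)" by (simp add: mult.assoc)
      finally show "f * c f * (e * b e) = 0" using none ef by auto
    qed
    finally show False using \<kappa>_nonzero idm_nonzero[OF n_pos] by simp
  qed
  then obtain e f where ef: "e \<in> E" "f \<in> E" "c f * b e \<noteq> 0" by blast
  then obtain d where d: "c f * b e = sc d (idm n)" using cb by blast
  hence d0: "d \<noteq> 0" using ef by auto
  define b' where "b' = sc (1 / d) (c f)"
  have M: "b e \<in> M n" "b' \<in> M n" using centr_M[OF bB[OF ef(1)]] centr_M[OF cB[OF ef(2)]] by (simp_all add: b'_def)
  have b'b: "b' * b e = idm n" using d d0 by (simp add: b'_def)
  hence bb': "b e * b' = idm n" using left_inverse_right_inverse M by blast
  have "fdet n b' * fdet n (b e) = 1" using fdet_mult[OF M(2), of "b e"] b'b by simp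
  hence dt0: "fdet n (b e) \<noteq> 0" by auto
  \<comment> \<open>Multiplication by \<open>t\<close> will normalize the determinant.\<close>
  have "card {t :: complex. t ^ n = 1 / fdet n (b e)} = n" using dt0 n_pos by (intro card_nth_roots) auto
  then obtain t where t: "t ^ n = 1 / fdet n (b e)" using n_pos by (cases "{t. t ^ n = 1 / fdet n (b e)} = {}") auto
  hence t0: "t \<noteq> 0" using dt0 n_pos by (auto simp: power_0_left)
  show ?thesis
  proof (rule that[of "sc t (b e)" "sc (1 / t) b'"])
    show "sc t (b e) \<in> B" "sc (1 / t) b' \<in> B"
      using bB cB ef by (auto simp: b'_def intro!: centr_sc)
    show "fdet n (sc t (b e)) = 1" using t dt0 by (simp add: fdet_sc)
    show "cj k y * sc t (b e) = sc t (b e) * y" if "y \<in> B" for y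
      using b_twist[OF ef(1) that] by simp
  qed (use t0 b'b bb' in auto)
qed

subsection \<open>Enlarging the group\<close>

text \<open>
  An element of \<open>B\<close> is determined by its action on \<open>B\<close> up to a scalar. Determinant one reduces
  this to finitely many choices and is preserved by products and by conjugation.
\<close>

definition inner_elts :: "'a set \<Rightarrow> fsm set"
  where "inner_elts K = {b \<in> B. fdet n b = 1 \<and> (\<exists>b'\<in>B. b * b' = idm n \<and> b' * b = idm n) \<and>
    (\<exists>k\<in>K. \<forall>y\<in>B. cj k y * b = b * y)}"

lemma inner_elts_proportional:
  assumes b: "b \<in> B" "\<And>y. y \<in> B \<Longrightarrow> cj k y * b = b * y"
    and c: "c \<in> B" "\<And>y. y \<in> B \<Longrightarrow> cj l y * c = c * y"
    and c': "c' \<in> B" "c * c' = idm n" "c' * c = idm n"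
    and l: "l \<in> carrier G" and kl: "\<And>y. y \<in> B \<Longrightarrow> cj k y = cj l y"
  shows "\<exists>s. b = sc s c"
proof -
  have M: "b \<in> M n" "c \<in> M n" "c' \<in> M n" using b c c' centr_M by auto
  have "\<exists>s. c' * b = sc s (idm n)"
  proof (rule B_center_scalar)
    fix y assume y: "y \<in> B"
    have yM: "y \<in> M n" using y by (rule centr_M)
    have "c' * cj l y = c' * (cj l y * c) * c'" using l yM M c' by (simp add: mult.assoc)
    also have "\<dots> = (c' * c) * y * c'" by (simp only: c(2)[OF y] mult.assoc)
    also have "\<dots> = y * c'" using yM c' by simp
    finally have 1: "c' * cj l y = y * c'" .
    have "c' * b * y = c' * (cj k y * b)" by (simp only: b(2)[OF y] mult.assoc)
    also have "\<dots> = (c' * cj l y) * b" by (simp only: kl[OF y] mult.assoc)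
    finally show "c' * b * y = y * (c' * b)" by (simp only: 1 mult.assoc)
  qed (use b c' centr_mult in auto)
  then obtain s where "c' * b = sc s (idm n)" by blast
  hence "c * (c' * b) = sc s c" using M by simp
  hence "b = sc s c" using M c'(2) by (simp flip: mult.assoc)
  thus ?thesis by blast
qed

text \<open>
  The commutators are scalar since \<open>K\<close> acts on \<open>B\<close> as an abelian group.
\<close>

lemma heisenberg_inner_elts:
  assumes K: "K \<lhd> G"
    and comm: "\<And>k l y. k \<in> K \<Longrightarrow> l \<in> K \<Longrightarrow> y \<in> B \<Longrightarrow> cj (k \<otimes> l) y = cj (l \<otimes> k) y"
  shows "heisenberg G n R (inner_elts K)"
proof -
  interpret K: normal K G by fact
  have KG: "k \<in> carrier G" if "k \<in> K" for k using that K.subset by auto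
  have idB: "idm n \<in> B" by (auto simp: centr_def)
  have intro: "b \<in> inner_elts K"
    if "b \<in> B" "fdet n b = 1" "b' \<in> B" "b * b' = idm n" "b' * b = idm n" "k \<in> K"
      "\<And>y. y \<in> B \<Longrightarrow> cj k y * b = b * y" for b b' k
    using that unfolding inner_elts_def by blast
  have elim: thesis if "b \<in> inner_elts K"
      "\<And>b' k. b \<in> B \<Longrightarrow> fdet n b = 1 \<Longrightarrow> b' \<in> B \<Longrightarrow> b * b' = idm n \<Longrightarrow> b' * b = idm n \<Longrightarrow> k \<in> K \<Longrightarrow>
        (\<And>y. y \<in> B \<Longrightarrow> cj k y * b = b * y) \<Longrightarrow> thesis" for b thesis
    using that unfolding inner_elts_def by blast
  have prod: "cj (k \<otimes> l) y * (b * c) = (b * c) * y"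
    if "k \<in> K" "l \<in> K" "\<And>y. y \<in> B \<Longrightarrow> cj k y * b = b * y" "\<And>y. y \<in> B \<Longrightarrow> cj l y * c = c * y" "y \<in> B"
    for k l b c y
  proof -
    have "cj (k \<otimes> l) y * (b * c) = cj k (cj l y) * b * c"
      using that KG by (simp add: cj_comp mult.assoc)
    also have "\<dots> = b * (cj l y * c)"
      using that(3)[OF cj_B[OF KG[OF that(2)] that(5)]] by (simp add: mult.assoc)
    finally show ?thesis using that(4,5) by (simp add: mult.assoc)
  qed
  have inv2: "(b * c) * (c' * b') = idm n"
    if "b * b' = idm n" "c * c' = idm n" "b' \<in> B" for b c b' c'
  proof -
    have "(b * c) * (c' * b') = b * ((c * c') * b')" by (simp only: mult.assoc)
    thus ?thesis using that centr_M by simp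
  qed
  have "mgrp n (inner_elts K)"
  proof
    show "inner_elts K \<subseteq> M n" using centr_M by (auto simp: inner_elts_def)
    show "idm n \<in> inner_elts K"
      by (rule intro[of _ "idm n" \<one>]) (use idB K.one_closed in \<open>auto dest: centr_M\<close>)
    show "b * c \<in> inner_elts K" if b: "b \<in> inner_elts K" and c: "c \<in> inner_elts K" for b c
    proof (rule elim[OF b], rule elim[OF c])
      fix b' k c' l
      assume *: "b \<in> B" "fdet n b = 1" "b' \<in> B" "b * b' = idm n" "b' * b = idm n" "k \<in> K"
        "\<And>y. y \<in> B \<Longrightarrow> cj k y * b = b * y"
        "c \<in> B" "fdet n c = 1" "c' \<in> B" "c * c' = idm n" "c' * c = idm n" "l \<in> K"
        "\<And>y. y \<in> B \<Longrightarrow> cj l y * c = c * y"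
      show ?thesis
      proof (rule intro[of _ "c' * b'" "k \<otimes> l"])
        show "fdet n (b * c) = 1" using * centr_M by (simp add: fdet_mult)
        show "cj (k \<otimes> l) y * (b * c) = b * c * y" if "y \<in> B" for y
          using prod[of k l b c y] * that by blast
      qed (use * inv2 centr_mult in auto)
    qed
    show "\<exists>t\<in>inner_elts K. b * t = idm n \<and> t * b = idm n" if b: "b \<in> inner_elts K" for b
    proof (rule elim[OF b])
      fix b' k
      assume *: "b \<in> B" "fdet n b = 1" "b' \<in> B" "b * b' = idm n" "b' * b = idm n" "k \<in> K"
        "\<And>y. y \<in> B \<Longrightarrow> cj k y * b = b * y"
      have "b' \<in> inner_elts K"
      proof (rule intro[of _ b "inv k"])
        show "fdet n b' = 1" using fdet_mult[of b n b'] * centr_M by simp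
        show "cj (inv k) y * b' = b' * y" if y: "y \<in> B" for y
        proof -
          define z where "z = cj (inv k) y"
          have z: "z \<in> B" "cj k z = y" using y KG[OF *(6)] centr_M cj_B by (auto simp: z_def)
          have "z * b' = b' * (b * z) * b'" using * z centr_M by (simp flip: mult.assoc)
          also have "\<dots> = b' * y * (b * b')" by (simp only: *(7)[OF z(1), symmetric] z(2) mult.assoc)
          finally show ?thesis using * y centr_M by (simp add: z_def)
        qed
      qed (use * in auto)
      thus ?thesis using * by blast
    qed
    show "finite (inner_elts K)"
    proof -
      define F where "F k = {b \<in> inner_elts K. \<forall>y\<in>B. cj k y * b = b * y}" for k
      have "finite (F k)" if k: "k \<in> K" for k
      proof (cases "F k = {}")
        case False
        then obtain c where c: "c \<in> F k" by auto
        hence cI: "c \<in> inner_elts K" by (simp add: F_def)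
        show ?thesis
        proof (rule elim[OF cI])
          fix c' l
          assume *: "c \<in> B" "fdet n c = 1" "c' \<in> B" "c * c' = idm n" "c' * c = idm n"
          have "F k \<subseteq> (\<lambda>s. sc s c) ` {s. s ^ n = 1}"
          proof
            fix b assume b: "b \<in> F k"
            hence "b \<in> B" "fdet n b = 1" by (auto simp: F_def inner_elts_def)
            moreover from this have "\<exists>s. b = sc s c"
              using inner_elts_proportional[of b k c k c'] b c * KG[OF k] by (auto simp: F_def)
            ultimately show "b \<in> (\<lambda>s. sc s c) ` {s. s ^ n = 1}"
              using *(2) by (auto simp: fdet_sc)
          qed
          thus ?thesis using finite_nth_roots[OF n_pos, of 1] by (rule finite_subset[OF _ finite_imageI])
        qed
      qed simp
      moreover have "inner_elts K \<subseteq> (\<Union>k\<in>K. F k)" by (auto simp: F_def inner_elts_def)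
      moreover have "finite K" using K.subset finite_G by (rule finite_subset)
      ultimately show ?thesis by (meson finite_UN_I finite_subset)
    qed
  qed
  moreover have "heisenberg_axioms G R (inner_elts K)"
  proof
    show "cj g b \<in> inner_elts K" if g: "g \<in> carrier G" and b: "b \<in> inner_elts K" for g b
    proof (rule elim[OF b])
      fix b' k
      assume *: "b \<in> B" "fdet n b = 1" "b' \<in> B" "b * b' = idm n" "b' * b = idm n" "k \<in> K"
        "\<And>y. y \<in> B \<Longrightarrow> cj k y * b = b * y"
      show ?thesis
      proof (rule intro[of _ "cj g b'" "g \<otimes> k \<otimes> inv g"])
        show "cj g b \<in> B" "cj g b' \<in> B" using * g cj_B by auto
        show "fdet n (cj g b) = 1" using * g centr_M by (simp add: fdet_cj)
        show "cj g b * cj g b' = idm n" "cj g b' * cj g b = idm n"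
          using * g centr_M by (simp_all flip: cj_mult)
        show "g \<otimes> k \<otimes> inv g \<in> K" using K.inv_op_closed2 g * by simp
        show "cj (g \<otimes> k \<otimes> inv g) y * cj g b = cj g b * y" if y: "y \<in> B" for y
        proof -
          define z where "z = cj (inv g) y"
          have z: "z \<in> B" "cj g z = y" using y g centr_M cj_B by (auto simp: z_def)
          have "cj (g \<otimes> k \<otimes> inv g) y * cj g b = cj g (cj k z) * cj g b"
            using g * KG by (simp add: cj_comp z_def)
          also have "\<dots> = cj g (cj k z * b)"
            using g KG[OF *(6)] centr_M[OF z(1)] centr_M[OF *(1)] by (simp add: cj_mult)
          also have "cj k z * b = b * z" by (rule *(7)[OF z(1)])
          also have "cj g (b * z) = cj g b * y"
            using g centr_M[OF z(1)] centr_M[OF *(1)] z(2) by (simp add: cj_mult)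
          finally show ?thesis .
        qed
      qed
    qed
    show "\<exists>s. b * c = sc s (c * b)" if b: "b \<in> inner_elts K" and c: "c \<in> inner_elts K" for b c
    proof (rule elim[OF b], rule elim[OF c])
      fix b' k c' l
      assume *: "b \<in> B" "fdet n b = 1" "b' \<in> B" "b * b' = idm n" "b' * b = idm n" "k \<in> K"
        "\<And>y. y \<in> B \<Longrightarrow> cj k y * b = b * y"
        "c \<in> B" "fdet n c = 1" "c' \<in> B" "c * c' = idm n" "c' * c = idm n" "l \<in> K"
        "\<And>y. y \<in> B \<Longrightarrow> cj l y * c = c * y"
      show ?thesis
      proof (rule inner_elts_proportional[of _ "k \<otimes> l" _ "l \<otimes> k" "b' * c'"])
        show "cj (k \<otimes> l) y * (b * c) = b * c * y" if "y \<in> B" for y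
          using prod[of k l b c y] * that by blast
        show "cj (l \<otimes> k) y * (c * b) = c * b * y" if "y \<in> B" for y
          using prod[of l k c b y] * that by blast
        show "l \<otimes> k \<in> carrier G" using * KG by simp
      qed (use * inv2 centr_mult comm in auto)
    qed
  qed
  ultimately show ?thesis by (intro heisenberg.intro prim_rep_axioms)
qed

lemma heisenberg_product:
  assumes F: "heisenberg G n R F" and FB: "F \<subseteq> B"
  shows "heisenberg G n R {e * f | e f. e \<in> E \<and> f \<in> F}"
proof -
  interpret F: heisenberg G n R F by fact
  define P where "P = {e * f | e f. e \<in> E \<and> f \<in> F}"
  have PI: "e * f \<in> P" if "e \<in> E" "f \<in> F" for e f using that by (auto simp: P_def)
  have ef: "e * f = f * e" if "e \<in> E" "f \<in> F" for e f using that FB B_commute by auto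
  have mult: "(e * f) * (e' * f') = (e * e') * (f * f')" if "e' \<in> E" "f \<in> F" for e f e' f'
  proof -
    have "(e * f) * (e' * f') = e * (f * e') * f'" by (simp only: mult.assoc)
    also have "\<dots> = (e * e') * (f * f')" by (simp only: ef[OF that, symmetric] mult.assoc)
    finally show ?thesis .
  qed
  have "mgrp n P"
  proof
    have "P = (\<lambda>(e, f). e * f) ` (E \<times> F)" by (auto simp: P_def)
    thus "finite P" using E.finite_S F.E.finite_S by simp
    show "P \<subseteq> M n" by (auto simp: P_def)
    show "idm n \<in> P" using PI[OF E.one_S F.E.one_S] by simp
    show "s * t \<in> P" if "s \<in> P" "t \<in> P" for s t
      using that by (auto simp: P_def mult) (use E.mult_S F.E.mult_S in blast)
    show "\<exists>t\<in>P. s * t = idm n \<and> t * s = idm n" if s: "s \<in> P" for s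
    proof -
      obtain e f where ef: "s = e * f" "e \<in> E" "f \<in> F" using s by (auto simp: P_def)
      have inv: "minv n e \<in> E" "minv n f \<in> F" using ef E.inv_facts F.E.inv_facts by auto
      show ?thesis
      proof (intro bexI conjI)
        show "minv n e * minv n f \<in> P" using inv by (rule PI)
        show "s * (minv n e * minv n f) = idm n"
          using mult[OF inv(1) ef(3), of e "minv n f"] ef by (simp add: E.inv_facts F.E.inv_facts)
        show "minv n e * minv n f * s = idm n"
          using mult[OF ef(2) inv(2), of "minv n e" f] ef by (simp add: E.inv_facts F.E.inv_facts)
      qed
    qed
  qed
  moreover have "heisenberg_axioms G R P"
  proof
    show "cj g s \<in> P" if "g \<in> carrier G" "s \<in> P" for g s
      using that PI stable F.stable by (auto simp: P_def cj_mult)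
    show "\<exists>c. s * t = sc c (t * s)" if "s \<in> P" "t \<in> P" for s t
    proof -
      obtain e f where s: "s = e * f" "e \<in> E" "f \<in> F" using \<open>s \<in> P\<close> by (auto simp: P_def)
      obtain e' f' where t: "t = e' * f'" "e' \<in> E" "f' \<in> F" using \<open>t \<in> P\<close> by (auto simp: P_def)
      obtain c where c: "e * e' = sc c (e' * e)" using commutator s t by blast
      obtain d where d: "f * f' = sc d (f' * f)" using F.commutator s t by blast
      have "s * t = sc (c * d) (t * s)" using s t by (simp add: mult c d mult.commute)
      thus ?thesis by blast
    qed
  qed
  ultimately show ?thesis unfolding P_def[symmetric] by (intro heisenberg.intro prim_rep_axioms)
qed

text \<open>
  The centralizer of the enlarged group is contained in \<open>B\<close> and commutes with the elements of \<open>B\<close>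
  that induce the action of \<open>K\<close>. So \<open>K\<close> acts trivially on it.
\<close>

lemma enlarge:
  assumes K: "K \<lhd> G" and der: "derived G K \<subseteq> act_ker E" and notker: "\<not> K \<subseteq> act_ker E"
  shows "\<exists>E'. heisenberg G n R E' \<and> act_ker E \<subset> act_ker E'"
proof -
  interpret K: normal K G by fact
  have KG: "k \<in> carrier G" if "k \<in> K" for k using that K.subset by auto
  have "cj (k \<otimes> l) y = cj (l \<otimes> k) y" if kl: "k \<in> K" "l \<in> K" and y: "y \<in> B" for k l y
  proof -
    define d where "d = inv k \<otimes> inv l \<otimes> k \<otimes> l"
    have kl': "k \<in> carrier G" "l \<in> carrier G" using kl KG by auto
    have "inv k \<otimes> inv l \<otimes> inv (inv k) \<otimes> inv (inv l) \<in> derived_set G K" using kl by blast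
    hence "d \<in> derived_set G K" using kl' by (simp add: d_def)
    hence "d \<in> act_ker E" using der by (auto simp: derived_def intro: generate.incl)
    hence d: "d \<in> carrier G" "cj d y = y" using y by (auto simp: act_ker_def)
    have "l \<otimes> k \<otimes> d = k \<otimes> l"
      using kl' by (simp add: d_def m_assoc) (simp flip: m_assoc)
    hence "cj (k \<otimes> l) y = cj (l \<otimes> k \<otimes> d) y" by simp
    thus ?thesis using d kl' by (simp add: cj_comp)
  qed
  hence F: "heisenberg G n R (inner_elts K)" by (rule heisenberg_inner_elts[OF K])
  interpret F: heisenberg G n R "inner_elts K" by fact
  define E' where "E' = {e * f | e f. e \<in> E \<and> f \<in> inner_elts K}"
  have E': "heisenberg G n R E'"
    unfolding E'_def by (rule heisenberg_product[OF F]) (auto simp: inner_elts_def)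
  have "e \<in> E'" if "e \<in> E" for e
  proof -
    have "e * idm n \<in> E'" using that F.E.one_S unfolding E'_def by blast
    thus ?thesis using that by simp
  qed
  hence sub: "centr E' \<subseteq> B" by (auto simp: centr_def)
  have "b \<in> E'" if "b \<in> inner_elts K" for b
  proof -
    have "idm n * b \<in> E'" using that E.one_S unfolding E'_def by blast
    thus ?thesis using that by simp
  qed
  hence comm: "b * y = y * b" if "b \<in> inner_elts K" "y \<in> centr E'" for b y
    using that by (auto simp: centr_def)
  have "act_ker E \<subseteq> act_ker E'" using sub by (auto simp: act_ker_def)
  moreover have "K \<subseteq> act_ker E'"
  proof
    fix k assume k: "k \<in> K"
    obtain b b' where b: "b \<in> B" "b' \<in> B" "b * b' = idm n" "b' * b = idm n" "fdet n b = 1"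
      "\<And>y. y \<in> B \<Longrightarrow> cj k y * b = b * y"
      using inner_on_B[OF KG[OF k]] by blast
    hence bI: "b \<in> inner_elts K" using k unfolding inner_elts_def by blast
    have "cj k y = y" if y: "y \<in> centr E'" for y
    proof -
      have yM: "y \<in> M n" using y by (rule centr_M)
      have "cj k y * b = y * b" using b(6) y sub comm[OF bI y] by auto
      hence "cj k y * b * b' = y * b * b'" by simp
      thus ?thesis using yM b(3) KG[OF k] by (simp add: mult.assoc)
    qed
    thus "k \<in> act_ker E'" using KG[OF k] by (auto simp: act_ker_def)
  qed
  ultimately show ?thesis using E' notker by blast
qed

end

text \<open>
  For a group \<open>E\<close> with the largest possible kernel of the action on its centralizer, the kernel is
  all of \<open>G\<close>. Otherwise \<open>E\<close> could be enlarged by the last term of the derived series that is not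
  contained in the kernel.
\<close>

lemma (in prim_rep) exists_irreducible_heisenberg:
  assumes "solvable G"
  shows "\<exists>E. heisenberg G n R E \<and> (\<forall>y\<in>centr E. \<exists>c. y = sc c (idm n))"
proof -
  have "heisenberg G n R {idm n}"
  proof (intro heisenberg.intro prim_rep_axioms)
    show "mgrp n {idm n}" by unfold_locales auto
    show "heisenberg_axioms G R {idm n}"
      by unfold_locales (auto intro!: exI[of _ 1])
  qed
  moreover have "card (act_ker E) < Suc (card (carrier G))" for E
    unfolding less_Suc_eq_le by (rule card_mono[OF finite_G]) (auto simp: act_ker_def)
  ultimately obtain E where E: "heisenberg G n R E"
    and max: "\<And>E'. heisenberg G n R E' \<Longrightarrow> card (act_ker E') \<le> card (act_ker E)"
    using ex_has_greatest_nat[of "heisenberg G n R" "{idm n}" "\<lambda>E. card (act_ker E)"] by blast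
  interpret heisenberg G n R E by fact
  have "carrier G \<subseteq> act_ker E"
  proof (rule ccontr)
    assume notall: "\<not> carrier G \<subseteq> act_ker E"
    define D where "D i = (derived G ^^ i) (carrier G)" for i
    have Dn: "D i \<lhd> G" for i
      by (induction i) (auto simp: D_def normal_self intro: derived_is_normal)
    obtain m where "D m = {\<one>}"
      using assms solvable_iff_trivial_derived_seq by (auto simp: D_def)
    hence "D m \<subseteq> act_ker E" by (auto simp: act_ker_def dest: centr_M)
    moreover have "\<not> D 0 \<subseteq> act_ker E" using notall by (simp add: D_def)
    ultimately have "\<exists>i<m. (\<forall>j\<le>i. \<not> D j \<subseteq> act_ker E) \<and> D (Suc i) \<subseteq> act_ker E"
      by (intro ex_least_nat_less)
    then obtain i where i: "\<not> D i \<subseteq> act_ker E" "D (Suc i) \<subseteq> act_ker E" by blast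
    obtain E' where E': "heisenberg G n R E'" "act_ker E \<subset> act_ker E'"
      using enlarge[OF Dn, of i] i by (auto simp: D_def)
    have "finite (act_ker E')" using finite_G by (simp add: act_ker_def)
    hence "card (act_ker E) < card (act_ker E')" using E'(2) by (rule psubset_card_mono)
    thus False using max[OF E'(1)] by simp
  qed
  hence comm: "R g * y = y * R g" if "g \<in> carrier G" "y \<in> centr E" for g y
    using that cj_eq_iff_commute[of g y y] centr_M[OF that(2)] by (auto simp: act_ker_def)
  have "\<exists>c. y = sc c (idm n)" if "y \<in> centr E" for y
    by (rule schur[OF centr_M[OF that] comm[OF _ that]])
  thus ?thesis using E by blast
qed

section \<open>The parity basis\<close>

locale irreducible_heisenberg = heisenberg +
  assumes B_scalar: "y \<in> centr E \<Longrightarrow> \<exists>c. y = sc c (idm n)"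
    and odd_n: "odd n"
begin

text \<open>
  For invertible \<open>X\<close> the condition says that \<open>X\<^sup>-\<^sup>1 e X\<close> is the inverse of \<open>e\<close> up to a scalar. In
  this form it is linear in \<open>X\<close>: the reflecting matrices are the joint eigenvectors of the
  commuting maps \<open>X \<mapsto> e X e\<close>.
\<close>

definition reflecting :: "fsm \<Rightarrow> bool"
  where "reflecting X \<longleftrightarrow> X \<in> M n \<and> (\<forall>e\<in>E. \<exists>c. e * X * e = sc c X)"

definition parities :: "fsm set"
  where "parities = {P. reflecting P \<and> P * P = idm n \<and> fdet n P = 1}"

lemma reflecting_M: "reflecting X \<Longrightarrow> X \<in> M n" by (simp add: reflecting_def)

lemma reflecting_generate:
  assumes "0 \<in> Q" "\<And>x y. x \<in> Q \<Longrightarrow> y \<in> Q \<Longrightarrow> x + y \<in> Q" "\<And>X. reflecting X \<Longrightarrow> X \<in> Q"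
  shows "M n \<subseteq> Q"
proof -
  define L where "L e X = e * X * e" for e X :: fsm
  show ?thesis
  proof (rule simultaneous_eigenvectors_generate[of "L ` E"])
    show "finite (L ` E)" using E.finite_S by simp
    show "fsm.subspace (M n)" by (auto simp: fsm.subspace_def)
    show "\<exists>k>0. \<forall>x\<in>M n. (D ^^ k) x = x" if "D \<in> L ` E" for D
    proof -
      obtain e where "e \<in> E" "D = L e" using \<open>D \<in> L ` E\<close> by blast
      hence e: "e \<in> E" "D = (\<lambda>X. e * X * e)" by (simp_all add: L_def fun_eq_iff)
      obtain k where k: "k > 0" "((*) e ^^ k) (idm n) = idm n" using E.finite_order[OF e(1)] .
      have "(D ^^ k) x = x" if "x \<in> M n" for x
        using E.funpow_sandwich[OF that e(1), of k] k(2) e(2) that by simp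
      thus ?thesis using k(1) by blast
    qed
    show "D (D' X) = D' (D X)" if "D \<in> L ` E" "D' \<in> L ` E" for D D' X
    proof -
      obtain e f where ef: "e \<in> E" "f \<in> E" "D = L e" "D' = L f" using \<open>D \<in> L ` E\<close> \<open>D' \<in> L ` E\<close> by auto
      obtain c where c: "e * f = sc c (f * e)" using commutator ef by blast
      have "D (D' X) = (e * f) * X * (f * e)" by (simp only: ef L_def mult.assoc)
      also have "\<dots> = (f * e) * X * (e * f)" by (simp add: c)
      also have "\<dots> = D' (D X)" by (simp only: ef L_def mult.assoc)
      finally show ?thesis .
    qed
    show "X \<in> Q" if X: "X \<in> M n" "\<And>D. D \<in> L ` E \<Longrightarrow> \<exists>c. D X = sc c X" for X
    proof -
      have "\<exists>c. e * X * e = sc c X" if "e \<in> E" for e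
        using X(2)[of "L e"] that by (simp add: L_def)
      thus ?thesis using X(1) by (intro assms(3)) (simp add: reflecting_def)
    qed
  qed (use assms in \<open>auto simp: L_def algebra_simps\<close>)
qed

lemma reflecting_weight_nonzero:
  assumes "e \<in> E" "X \<in> M n" "X \<noteq> 0" "e * X * e = sc c X"
  shows "c \<noteq> 0"
proof
  assume "c = 0"
  hence "minv n e * (e * X * e) * minv n e = 0" using assms by simp
  thus False using assms by (simp add: mult.assoc E.inv_facts)
qed

text \<open>
  Moving \<open>e\<close> past \<open>X\<close> inverts it, and moving it past \<open>Y\<close> inverts it back.
\<close>

lemma reflecting_mult:
  assumes e: "e \<in> E" and X: "X \<in> M n" "e * X * e = sc c X"
    and Y: "Y \<in> M n" "e * Y * e = sc d Y" "d \<noteq> 0"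
  shows "e * (X * Y) = sc (c / d) (X * Y * e)"
proof -
  have "(e * X * e) * minv n e = sc c (X * minv n e)" by (simp add: X)
  hence 1: "e * X = sc c (X * minv n e)" using e X by (simp add: mult.assoc E.inv_facts)
  have "minv n e * (e * Y * e) = sc d (minv n e * Y)" by (simp add: Y)
  hence "Y * e = sc d (minv n e * Y)" using e Y by (simp add: mult.assoc)
  hence 2: "minv n e * Y = sc (1 / d) (Y * e)" using Y(3) by simp
  have "e * (X * Y) = (e * X) * Y" by (simp only: mult.assoc)
  also have "\<dots> = sc c (X * (minv n e * Y))" by (simp add: 1 mult.assoc)
  finally show ?thesis by (simp add: 2 mult.assoc)
qed

lemma reflecting_same_weight:
  assumes "reflecting X" "reflecting Y" "Y \<noteq> 0"
    and w: "\<And>e c. e \<in> E \<Longrightarrow> e * X * e = sc c X \<Longrightarrow> e * Y * e = sc c Y"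
  shows "\<exists>s. X * Y = sc s (idm n)"
proof (rule B_scalar)
  have M: "X \<in> M n" "Y \<in> M n" using assms reflecting_M by auto
  have "e * (X * Y) = X * Y * e" if e: "e \<in> E" for e
  proof -
    obtain c where c: "e * X * e = sc c X" using assms(1) e by (auto simp: reflecting_def)
    have "c \<noteq> 0" using reflecting_weight_nonzero[OF e M(2) assms(3) w[OF e c]] .
    thus ?thesis using reflecting_mult[OF e M(1) c M(2) w[OF e c]] by simp
  qed
  thus "X * Y \<in> centr E" using M by (auto simp: centr_def)
qed

text \<open>
  The product \<open>X Y\<close> is conjugate to its multiple by the quotient of the two weights at \<open>e\<close>. The
  trace can be nonzero only if that quotient is one.
\<close>

lemma reflecting_tr_nonzero:
  assumes X: "reflecting X" and Y: "reflecting Y" and tr: "tr (X * Y) \<noteq> 0"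
    and e: "e \<in> E" and c: "e * X * e = sc c X"
  shows "e * Y * e = sc c Y"
proof -
  have M: "X \<in> M n" "Y \<in> M n" using assms reflecting_M by auto
  have "Y \<noteq> 0" using tr by auto
  obtain d where d: "e * Y * e = sc d Y" using Y e by (auto simp: reflecting_def)
  have "d \<noteq> 0" by (rule reflecting_weight_nonzero[OF e M(2) \<open>Y \<noteq> 0\<close> d])
  hence "e * (X * Y) * minv n e = sc (c / d) (X * Y * e * minv n e)"
    using reflecting_mult[OF e M(1) c M(2) d] by simp
  also have "X * Y * e * minv n e = X * Y" using e M by (simp add: mult.assoc E.inv_facts)
  finally have "tr (e * (X * Y) * minv n e) = c / d * tr (X * Y)" by simp
  moreover have "tr (e * (X * Y) * minv n e) = tr (X * Y)"
    using tr_commute[of "e * (X * Y)" "minv n e"] e M by simp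
  ultimately have "c = d" using tr \<open>d \<noteq> 0\<close> by (simp add: field_simps)
  thus ?thesis using d by simp
qed

text \<open>
  As the reflecting matrices generate \<open>M n\<close> and the trace form is nondegenerate, some reflecting
  \<open>Y\<close> has \<open>tr(X Y) \<noteq> 0\<close>. Then \<open>X\<close> and \<open>Y\<close> have equal weights and \<open>X Y\<close> is a nonzero
  scalar, so that \<open>X\<close> is invertible. Its square is again scalar, hence a multiple of \<open>X\<close> is an
  involution, and a change of sign corrects the determinant because \<open>n\<close> is odd.
\<close>

lemma reflecting_multiple_of_parity:
  assumes X: "reflecting X" and "X \<noteq> 0"
  shows "\<exists>t. \<exists>P\<in>parities. X = sc t P"
proof -
  have XM: "X \<in> M n" using X by (rule reflecting_M)
  have "\<exists>Y. reflecting Y \<and> tr (X * Y) \<noteq> 0"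
  proof (rule ccontr)
    assume none: "\<not> ?thesis"
    have "M n \<subseteq> {Y. tr (X * Y) = 0}"
      by (rule reflecting_generate) (use none in \<open>auto simp: distrib_left tr_add\<close>)
    hence "X = 0" by (intro tr_nondegenerate[OF XM]) auto
    thus False using \<open>X \<noteq> 0\<close> by simp
  qed
  then obtain Y where Y: "reflecting Y" "tr (X * Y) \<noteq> 0" by blast
  hence "Y \<noteq> 0" by auto
  obtain s where s: "X * Y = sc s (idm n)"
    using reflecting_same_weight[OF X Y(1) \<open>Y \<noteq> 0\<close> reflecting_tr_nonzero[OF X Y]] by blast
  hence s0: "s \<noteq> 0" using Y(2) by auto
  obtain u where u: "X * X = sc u (idm n)"
    using reflecting_same_weight[OF X X \<open>X \<noteq> 0\<close>] by blast
  have "u \<noteq> 0"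
  proof
    assume "u = 0"
    hence "X * (X * Y) = 0" using u by (simp flip: mult.assoc)
    thus False using s s0 XM \<open>X \<noteq> 0\<close> by simp
  qed
  define v where "v = csqrt (1 / u)"
  have v: "v * v * u = 1" "v \<noteq> 0"
    using \<open>u \<noteq> 0\<close> power2_csqrt[of "1 / u"] by (auto simp: v_def power2_eq_square)
  have "sc v X * sc v X = idm n" using v u by (simp add: mult_ac)
  hence "fdet n (sc v X) * fdet n (sc v X) = 1"
    using fdet_mult[of "sc v X" n "sc v X"] XM by simp
  hence "(fdet n (sc v X))\<^sup>2 = 1" by (simp only: power2_eq_square)
  hence "fdet n (sc v X) = 1 \<or> fdet n (sc v X) = - 1" by (simp add: power2_eq_1_iff)
  then obtain w where w: "w = v \<or> w = - v" "fdet n (sc w X) = 1"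
  proof
    assume "fdet n (sc v X) = - 1"
    moreover have "fdet n (sc (- v) X) = - fdet n (sc v X)" 
      by (simp only: fdet_sc power_minus_odd[OF odd_n]) simp
    ultimately show thesis using that[of "- v"] by simp
  qed (use that[of v] in simp)
  have w0: "w \<noteq> 0" and ww: "w * w * u = 1" using w(1) v by auto
  have "sc w X \<in> parities"
    unfolding parities_def
  proof (intro CollectI conjI)
    have "\<exists>c. e * sc w X * e = sc c (sc w X)" if e: "e \<in> E" for e
    proof -
      obtain c where "e * X * e = sc c X" using X e by (auto simp: reflecting_def)
      hence "e * sc w X * e = sc c (sc w X)" by (simp add: mult.commute)
      thus ?thesis by blast
    qed
    thus "reflecting (sc w X)" using XM by (simp add: reflecting_def)
    show "sc w X * sc w X = idm n" using ww u by (simp add: mult_ac)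
  qed (rule w(2))
  moreover have "X = sc (1 / w) (sc w X)" using w0 by simp
  ultimately show ?thesis by blast
qed

lemma parities_M: "P \<in> parities \<Longrightarrow> P \<in> M n"
  by (simp add: parities_def reflecting_M)

lemma parity_nonzero: "P \<in> parities \<Longrightarrow> P \<noteq> 0"
  using idm_nonzero[OF n_pos] by (auto simp: parities_def)

text \<open>
  Proportional parities differ by a sign, which the determinant detects because \<open>n\<close> is odd.
\<close>

lemma parities_proportional_eq:
  assumes P: "P \<in> parities" and Q: "Q \<in> parities" and s: "P * Q = sc s (idm n)"
  shows "P = Q"
proof -
  have M: "P \<in> M n" "Q \<in> M n" using P Q parities_M by auto
  have "P * (P * Q) = Q" using P M by (simp add: parities_def flip: mult.assoc)
  hence QsP: "Q = sc s P" using s M by simp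
  have "sc (s * s) (idm n) = idm n" using P Q by (auto simp: parities_def QsP)
  hence "sc (s * s) (idm n) = sc 1 (idm n)" by simp
  hence "s * s = 1" using idm_nonzero[OF n_pos] by (simp only: fsm.scale_cancel_right) simp
  hence "s = 1 \<or> s = - 1" using power2_eq_1_iff[of s] by (simp add: power2_eq_square)
  moreover have "s ^ n = 1" using P Q by (auto simp: parities_def QsP fdet_sc)
  ultimately have "s = 1" using odd_n by auto
  thus ?thesis using QsP by simp
qed

lemma parities_orthogonal:
  assumes P: "P \<in> parities" and Q: "Q \<in> parities"
  shows "tr (P * Q) = (if P = Q then of_nat n else 0)"
proof (cases "P = Q")
  case False
  have r: "reflecting P" "reflecting Q" using P Q by (auto simp: parities_def)
  have "tr (P * Q) = 0"
  proof (rule ccontr)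
    assume "tr (P * Q) \<noteq> 0"
    hence "\<exists>s. P * Q = sc s (idm n)"
      by (rule reflecting_same_weight[OF r parity_nonzero[OF Q] reflecting_tr_nonzero[OF r]])
    thus False using parities_proportional_eq[OF P Q] False by blast
  qed
  thus ?thesis using False by simp
qed (use P in \<open>simp add: parities_def\<close>)

text \<open>
  A parity is determined by its weight, whose values are roots of unity of bounded order.
\<close>

lemma finite_parities: "finite parities"
proof -
  have "\<exists>k>0. ((*) e ^^ k) (idm n) = idm n" if "e \<in> E" for e
    using E.finite_order[OF that] by blast
  then obtain k where k: "\<And>e. e \<in> E \<Longrightarrow> k e > 0 \<and> ((*) e ^^ k e) (idm n) = idm n" by metis
  define w where "w P = (\<lambda>e\<in>E. SOME c. e * P * e = sc c P)" for P
  have w: "e * P * e = sc (w P e) P" if "P \<in> parities" "e \<in> E" for P e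
  proof -
    have "\<exists>c. e * P * e = sc c P" using that by (auto simp: parities_def reflecting_def)
    from someI_ex[OF this] show ?thesis using that(2) by (simp add: w_def)
  qed
  have "w P \<in> PiE E (\<lambda>e. {c. c ^ k e = 1})" if P: "P \<in> parities" for P
  proof -
    have "w P e ^ k e = 1" if e: "e \<in> E" for e
    proof -
      have "((\<lambda>X. e * X * e) ^^ j) P = sc (w P e ^ j) P" for j
        by (induction j) (simp_all add: w[OF P e] mult.commute)
      moreover have "((\<lambda>X. e * X * e) ^^ k e) P = P"
        using E.funpow_sandwich[OF parities_M[OF P] e] k[OF e] parities_M[OF P] by simp
      ultimately have "sc (w P e ^ k e) P = sc 1 P" by simp
      thus ?thesis using parity_nonzero[OF P] by (simp only: fsm.scale_cancel_right) simp
    qed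
    thus ?thesis by (auto simp: w_def)
  qed
  moreover have "inj_on w parities"
  proof
    fix P Q assume PQ: "P \<in> parities" "Q \<in> parities" and eq: "w P = w Q"
    have "\<exists>s. P * Q = sc s (idm n)"
    proof (rule reflecting_same_weight)
      fix e c assume e: "e \<in> E" and c: "e * P * e = sc c P"
      have "sc c P = sc (w P e) P" by (rule trans[OF c[symmetric] w[OF PQ(1) e]])
      hence "c = w P e" using parity_nonzero[OF PQ(1)] by (simp only: fsm.scale_cancel_right) simp
      thus "e * Q * e = sc c Q" using w[OF PQ(2) e] eq by simp
    qed (use PQ parity_nonzero in \<open>auto simp: parities_def\<close>)
    thus "P = Q" using parities_proportional_eq[OF PQ] by blast
  qed
  moreover have "finite (PiE E (\<lambda>e. {c :: complex. c ^ k e = 1}))"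
    using k by (intro finite_PiE E.finite_S) (auto intro!: finite_nth_roots)
  ultimately show ?thesis by (meson finite_imageD finite_subset image_subsetI)
qed

lemma parity_expansion:
  assumes "X \<in> M n"
  shows "X = (\<Sum>P\<in>parities. sc (tr (P * X) / of_nat n) P)"
proof -
  have "M n \<subseteq> {X. X = (\<Sum>P\<in>parities. sc (tr (P * X) / of_nat n) P)}"
  proof (rule reflecting_generate)
    fix X Y
    assume XY: "X \<in> {X. X = (\<Sum>P\<in>parities. sc (tr (P * X) / of_nat n) P)}"
      "Y \<in> {X. X = (\<Sum>P\<in>parities. sc (tr (P * X) / of_nat n) P)}"
    have "(\<Sum>P\<in>parities. sc (tr (P * (X + Y)) / of_nat n) P)
      = (\<Sum>P\<in>parities. sc (tr (P * X) / of_nat n) P) + (\<Sum>P\<in>parities. sc (tr (P * Y) / of_nat n) P)"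
      by (simp add: distrib_left tr_add add_divide_distrib fsm.scale_left_distrib sum.distrib)
    thus "X + Y \<in> {X. X = (\<Sum>P\<in>parities. sc (tr (P * X) / of_nat n) P)}"
      using XY by simp
  next
    fix X assume X: "reflecting X"
    show "X \<in> {X. X = (\<Sum>P\<in>parities. sc (tr (P * X) / of_nat n) P)}"
    proof (cases "X = 0")
      case False
      then obtain t Q where tQ: "Q \<in> parities" "X = sc t Q"
        using reflecting_multiple_of_parity[OF X] by blast
      have "(\<Sum>P\<in>parities. sc (tr (P * X) / of_nat n) P) = (\<Sum>P\<in>parities. if P = Q then sc t Q else 0)"
        using tQ n_pos by (intro sum.cong) (auto simp: parities_orthogonal)
      also have "\<dots> = X" using tQ finite_parities by simp
      finally show ?thesis by simp
    qed simp
  qed simp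
  thus ?thesis using assms by blast
qed

text \<open>
  Since the parities form a basis that is its own dual up to the factor \<open>n\<close>, the right side is the
  trace of the linear map \<open>X \<mapsto> A X C\<close> on \<open>M n\<close>. The left side is the same trace, computed
  in the basis of matrix units.
\<close>

lemma parity_completeness:
  assumes A: "A \<in> M n" and C: "C \<in> M n"
  shows "tr A * tr C = (\<Sum>P\<in>parities. tr (P * A * P * C)) / of_nat n"
proof -
  have "ent A i i * ent C j j = (\<Sum>P\<in>parities. ent P j i * ent (A * P * C) i j / of_nat n)"
    if ij: "i < n" "j < n" for i j
  proof -
    have "ent A i i * ent C j j = tr (munit j i * A * munit i j * C)"
      by (simp add: munit_mult_mult tr_munit_mult)
    also have "munit i j = (\<Sum>P\<in>parities. sc (tr (P * munit i j) / of_nat n) P)"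
      using ij by (intro parity_expansion) simp
    also have "\<dots> = (\<Sum>P\<in>parities. sc (ent P j i / of_nat n) P)"
      by (simp only: tr_commute[where B = "munit i j"] tr_munit_mult)
    also have "tr (munit j i * A * (\<Sum>P\<in>parities. sc (ent P j i / of_nat n) P) * C)
      = (\<Sum>P\<in>parities. ent P j i / of_nat n * tr (munit j i * (A * P * C)))"
      by (simp add: sum_distrib_left sum_distrib_right tr_sum mult.assoc)
    finally show ?thesis by (simp add: tr_munit_mult)
  qed
  hence "tr A * tr C = (\<Sum>i<n. \<Sum>j<n. \<Sum>P\<in>parities. ent P j i * ent (A * P * C) i j / of_nat n)"
    using A C by (simp add: tr_eq[of _ n] sum_product)
  also have "\<dots> = (\<Sum>i<n. \<Sum>P\<in>parities. \<Sum>j<n. ent P j i * ent (A * P * C) i j / of_nat n)"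
    by (intro sum.cong refl sum.swap)
  also have "\<dots> = (\<Sum>P\<in>parities. \<Sum>i<n. \<Sum>j<n. ent P j i * ent (A * P * C) i j / of_nat n)"
    by (rule sum.swap)
  also have "\<dots> = (\<Sum>P\<in>parities. \<Sum>j<n. \<Sum>i<n. ent P j i * ent (A * P * C) i j / of_nat n)"
    by (intro sum.cong refl sum.swap)
  also have "\<dots> = (\<Sum>P\<in>parities. tr (P * (A * P * C)) / of_nat n)"
    using A C parities_M by (intro sum.cong) (simp_all add: tr_mult[of _ n] sum_divide_distrib)
  finally show ?thesis by (simp add: sum_divide_distrib mult.assoc)
qed

lemma cj_parities:
  assumes g: "g \<in> carrier G" and P: "P \<in> parities"
  shows "cj g P \<in> parities"
proof -
  have PM: "P \<in> M n" using P by (rule parities_M)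
  have "\<exists>c. e * cj g P * e = sc c (cj g P)" if e: "e \<in> E" for e
  proof -
    define f where "f = cj (inv g) e"
    have f: "f \<in> E" "cj g f = e" using stable g e by (auto simp: f_def)
    obtain c where c: "f * P * f = sc c P" using P f(1) by (auto simp: parities_def reflecting_def)
    have "e * cj g P * e = cj g (f * P * f)" using g PM f by (simp add: cj_mult)
    thus ?thesis by (auto simp: c cj_sc)
  qed
  hence "reflecting (cj g P)" using g PM by (simp add: reflecting_def)
  moreover have "cj g P * cj g P = idm n" using P g PM by (simp add: parities_def flip: cj_mult)
  ultimately show ?thesis using P g PM by (simp add: parities_def fdet_cj)
qed

theorem tr_mult_tr_inv:
  assumes g: "g \<in> carrier G"
  shows "tr (R g) * tr (R (inv g)) = of_nat (card {P \<in> parities. cj g P = P})"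
proof -
  have "P * R g * P * R (inv g) = P * cj g P" for P by (simp add: cj_def mult.assoc)
  hence "tr (R g) * tr (R (inv g)) = (\<Sum>P\<in>parities. tr (P * cj g P)) / of_nat n"
    using parity_completeness[of "R g" "R (inv g)"] g by simp
  also have "\<dots> = (\<Sum>P\<in>parities. if cj g P = P then 1 else 0)"
    unfolding sum_divide_distrib
    using n_pos by (intro sum.cong) (auto simp: parities_orthogonal cj_parities[OF g])
  also have "\<dots> = of_nat (card {P \<in> parities. cj g P = P})"
    using finite_parities by (simp add: sum.If_cases Int_def)
  finally show ?thesis .
qed

end

lemma (in fsm_rep) tr_inv_eq_cnj:
  assumes g: "g \<in> carrier G"
  shows "tr (R (inv g)) = cnj (tr (R g))"
proof -
  define S where "S = range (\<lambda>i::int. R (g [^] i))"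
  have mult: "R (g [^] i) * R (g [^] j) = R (g [^] (i + j))" for i j :: int
    using g by (simp add: int_pow_mult R_mult)
  interpret S: mgrp n S
  proof
    have "S \<subseteq> R ` carrier G" using g by (auto simp: S_def)
    thus "finite S" using finite_G by (meson finite_imageI finite_subset)
    show "S \<subseteq> M n" using g by (auto simp: S_def)
    have "R (g [^] (0::int)) \<in> S" unfolding S_def by blast
    thus "idm n \<in> S" by (simp add: R_one)
    show "s * t \<in> S" if "s \<in> S" "t \<in> S" for s t
      using that by (auto simp: S_def mult)
    show "\<exists>t\<in>S. s * t = idm n \<and> t * s = idm n" if "s \<in> S" for s
    proof -
      obtain i :: int where "s = R (g [^] i)" using \<open>s \<in> S\<close> by (auto simp: S_def)
      thus ?thesis by (intro bexI[of _ "R (g [^] (- i))"]) (auto simp: mult R_one S_def)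
    qed
  qed
  have gS: "R g \<in> S" using g by (auto simp: S_def intro!: image_eqI[of _ _ 1])
  have "minv n (R g) = R (inv g)" using gS g by (intro S.inv_unique) (auto simp: R_inv)
  moreover have "s * t = t * s" if "s \<in> S" "t \<in> S" for s t
    using that by (auto simp: S_def mult add.commute)
  ultimately show ?thesis using S.tr_inv[OF _ gS] by simp
qed

theorem (in prim_rep) norm_tr_le_norm_tr_power:
  assumes "solvable G" "odd n" and x: "x \<in> carrier G"
  shows "cmod (tr (R x)) \<le> cmod (tr (R (x [^] (m::int))))"
proof -
  obtain E where "heisenberg G n R E" and B: "\<And>y. y \<in> centr E \<Longrightarrow> \<exists>c. y = sc c (idm n)"
    using exists_irreducible_heisenberg[OF assms(1)] by blast
  then interpret heisenberg G n R E by simp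
  interpret irreducible_heisenberg G n R E
    by unfold_locales (use B assms(2) in auto)
  have norm: "(cmod (tr (R g)))\<^sup>2 = card {P \<in> parities. cj g P = P}" if g: "g \<in> carrier G" for g
  proof -
    have "complex_of_real ((cmod (tr (R g)))\<^sup>2) = tr (R g) * tr (R (inv g))"
      by (simp only: complex_norm_square tr_inv_eq_cnj[OF g])
    also have "\<dots> = complex_of_real (card {P \<in> parities. cj g P = P})"
      using tr_mult_tr_inv[OF g] by simp
    finally show ?thesis by (simp only: of_real_eq_iff)
  qed
  have "{P \<in> parities. cj x P = P} \<subseteq> {P \<in> parities. cj (x [^] m) P = P}"
  proof clarify
    fix P assume P: "P \<in> parities" "cj x P = P"
    have PM: "P \<in> M n" using P(1) by (rule parities_M)
    have "subgroup {g \<in> carrier G. cj g P = P} G"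
    proof (rule subgroupI)
      show "inv a \<in> {g \<in> carrier G. cj g P = P}" if "a \<in> {g \<in> carrier G. cj g P = P}" for a
        using that cj_cancel(2)[of a P] PM by auto
      have "\<one> \<in> {g \<in> carrier G. cj g P = P}" using PM by simp
      thus "{g \<in> carrier G. cj g P = P} \<noteq> {}" by blast
    qed (auto simp: cj_comp)
    hence "x [^] m \<in> {g \<in> carrier G. cj g P = P}"
      by (rule subgroup_int_pow_closed) (use x P in simp)
    thus "cj (x [^] m) P = P" by simp
  qed
  hence "card {P \<in> parities. cj x P = P} \<le> card {P \<in> parities. cj (x [^] m) P = P}"
    using finite_parities by (intro card_mono) auto
  hence "(cmod (tr (R x)))\<^sup>2 \<le> (cmod (tr (R (x [^] m))))\<^sup>2"
    using x by (simp add: norm)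
  thus ?thesis by (rule power2_le_imp_le) simp
qed

section \<open>From matrix representations to the theorem\<close>

text \<open>
  Both forms of irreducibility come down to an invariant eigenspace: for the eigenvalue one of an
  idempotent, and for some eigenvalue of a matrix in the commutant.
\<close>

lemma eigenspace_subspace:
  fixes A :: "complex mat"
  assumes A: "A \<in> carrier_mat n n"
  shows "VectorSpace.subspace class_ring {w \<in> carrier_vec n. A *\<^sub>v w = c \<cdot>\<^sub>v w}
    (module_vec TYPE(complex) n)"
proof -
  have "A *\<^sub>v 0\<^sub>v n = 0\<^sub>v n" using A by (intro eq_vecI) auto
  moreover have "c \<cdot>\<^sub>v 0\<^sub>v n = 0\<^sub>v n" by (intro eq_vecI) auto
  ultimately show ?thesis
    using A unfolding VectorSpace.subspace_def submodule_def
    by (auto simp: vec_vs vec_module module_vec_simps class_ring_simps mult_add_distrib_mat_vec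
        smult_add_distrib_vec mult_mat_vec smult_smult_assoc mult.commute)
qed

lemma eigenspace_eq_carrier:
  fixes A :: "complex mat"
  assumes A: "A \<in> carrier_mat n n" and W: "{w \<in> carrier_vec n. A *\<^sub>v w = c \<cdot>\<^sub>v w} = carrier_vec n"
  shows "A = c \<cdot>\<^sub>m 1\<^sub>m n"
proof (rule eq_matI)
  fix i j assume "i < dim_row (c \<cdot>\<^sub>m 1\<^sub>m n)" "j < dim_col (c \<cdot>\<^sub>m 1\<^sub>m n)"
  hence ij: "i < n" "j < n" by auto
  have "unit_vec n j \<in> {w \<in> carrier_vec n. A *\<^sub>v w = c \<cdot>\<^sub>v w}" using W by simp
  hence "(A *\<^sub>v unit_vec n j) $ i = (c \<cdot>\<^sub>v unit_vec n j) $ i" by simp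
  moreover have "(A *\<^sub>v unit_vec n j) $ i = A $$ (i, j)" using A ij by simp
  ultimately show "A $$ (i, j) = (c \<cdot>\<^sub>m 1\<^sub>m n) $$ (i, j)" using ij by (simp add: unit_vec_def)
qed (use A in auto)

lemma mat_rep_carrier:
  assumes "mat_rep G n \<rho>" "g \<in> carrier G"
  shows "\<rho> g \<in> carrier_mat n n"
proof -
  have "\<rho> g \<in> carrier (GL n)" using assms by (auto simp: mat_rep_def hom_def)
  thus ?thesis by (auto simp: GL_def units_of_def Units_def ring_mat_def)
qed

lemma irr_rep_of_mat:
  assumes "group G" "finite (carrier G)" and irr_\<rho>: "irreducible_mat_rep G n \<rho>"
  shows "irr_rep G n (\<lambda>g. of_mat (\<rho> g))"
proof -
  interpret group G by fact
  have n: "n > 0" and hom: "\<rho> \<in> hom G (GL n)"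
    using irr_\<rho> by (auto simp: irreducible_mat_rep_def mat_rep_def)
  have inv: "\<forall>W. VectorSpace.subspace class_ring W (module_vec TYPE(complex) n) \<longrightarrow>
         (\<forall>g\<in>carrier G. \<forall>w\<in>W. \<rho> g *\<^sub>v w \<in> W) \<longrightarrow> W = {0\<^sub>v n} \<or> W = carrier_vec n"
    using irr_\<rho> by (simp add: irreducible_mat_rep_def)
  have GL: "\<rho> g \<in> carrier_mat n n" "\<exists>y\<in>carrier_mat n n. y * \<rho> g = 1\<^sub>m n"
    if "g \<in> carrier G" for g
    using hom_in_carrier[OF hom that] by (auto simp: GL_def units_of_def Units_def ring_mat_def)
  have mult: "\<rho> (g \<otimes>\<^bsub>G\<^esub> h) = \<rho> g * \<rho> h" if "g \<in> carrier G" "h \<in> carrier G" for g h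
    using hom_mult[OF hom that] by (simp add: GL_def units_of_def ring_mat_def)
  have one: "\<rho> \<one>\<^bsub>G\<^esub> = 1\<^sub>m n"
  proof -
    obtain y where y: "y \<in> carrier_mat n n" "y * \<rho> \<one>\<^bsub>G\<^esub> = 1\<^sub>m n" using GL(2)[of "\<one>\<^bsub>G\<^esub>"] by auto
    have "y * (\<rho> \<one>\<^bsub>G\<^esub> * \<rho> \<one>\<^bsub>G\<^esub>) = y * \<rho> \<one>\<^bsub>G\<^esub>" using mult[of "\<one>\<^bsub>G\<^esub>" "\<one>\<^bsub>G\<^esub>"] by simp
    moreover have "y * (\<rho> \<one>\<^bsub>G\<^esub> * \<rho> \<one>\<^bsub>G\<^esub>) = (y * \<rho> \<one>\<^bsub>G\<^esub>) * \<rho> \<one>\<^bsub>G\<^esub>"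
      using y GL(1)[of "\<one>\<^bsub>G\<^esub>"] by (intro assoc_mult_mat[symmetric]) auto
    ultimately show ?thesis using y GL(1)[of "\<one>\<^bsub>G\<^esub>"] by simp
  qed
  have toR: "to_mat n n (of_mat (\<rho> g)) = \<rho> g" if "g \<in> carrier G" for g
    using GL(1)[OF that] by simp
  have eig: "{w \<in> carrier_vec n. A *\<^sub>v w = c \<cdot>\<^sub>v w} = {0\<^sub>v n} \<or> A = c \<cdot>\<^sub>m 1\<^sub>m n"
    if A: "A \<in> carrier_mat n n"
      and inv': "\<And>g w. g \<in> carrier G \<Longrightarrow> w \<in> carrier_vec n \<Longrightarrow> A *\<^sub>v w = c \<cdot>\<^sub>v w \<Longrightarrow>
        A *\<^sub>v (\<rho> g *\<^sub>v w) = c \<cdot>\<^sub>v (\<rho> g *\<^sub>v w)" for A c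
  proof -
    have "\<forall>g\<in>carrier G. \<forall>w\<in>{w \<in> carrier_vec n. A *\<^sub>v w = c \<cdot>\<^sub>v w}.
        \<rho> g *\<^sub>v w \<in> {w \<in> carrier_vec n. A *\<^sub>v w = c \<cdot>\<^sub>v w}"
      using inv' GL(1) by (auto intro: mult_mat_vec_carrier)
    thus ?thesis using inv eigenspace_subspace[OF A, of c] eigenspace_eq_carrier[OF A, of c] by blast
  qed
  show ?thesis
  proof
    show "of_mat (\<rho> (g \<otimes>\<^bsub>G\<^esub> h)) = of_mat (\<rho> g) * of_mat (\<rho> h)"
      if "g \<in> carrier G" "h \<in> carrier G" for g h
      using mult[OF that] of_mat_mult[OF GL(1)[OF that(1)] GL(1)[OF that(2)]] by simp
    show "e = idm n"
      if e: "e \<in> M n" "e * e = e" "e \<noteq> 0"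
        and ge: "\<And>g. g \<in> carrier G \<Longrightarrow> of_mat (\<rho> g) * e = e * of_mat (\<rho> g) * e" for e
    proof -
      define A where "A = to_mat n n e"
      have A: "A \<in> carrier_mat n n" "A * A = A"
        using to_mat_mult[OF e(1), of n e] e(2) by (auto simp: A_def)
      have gA: "\<rho> g * A = A * \<rho> g * A" if g: "g \<in> carrier G" for g
      proof -
        have "of_mat (\<rho> g) \<in> M n" using GL(1)[OF g] by simp
        thus ?thesis using arg_cong[OF ge[OF g], of "to_mat n n"] e(1) toR[OF g]
          by (simp add: to_mat_mult[of _ n n] A_def)
      qed
      have "{w \<in> carrier_vec n. A *\<^sub>v w = 1 \<cdot>\<^sub>v w} = {0\<^sub>v n} \<or> A = 1 \<cdot>\<^sub>m 1\<^sub>m n"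
      proof (rule eig[OF A(1)])
        fix g w assume g: "g \<in> carrier G" and w: "w \<in> carrier_vec n" "A *\<^sub>v w = 1 \<cdot>\<^sub>v w"
        have "\<rho> g *\<^sub>v w = (\<rho> g * A) *\<^sub>v w"
          using w A GL(1)[OF g] by (simp add: assoc_mult_mat_vec[of _ n n _ n])
        also have "\<dots> = A *\<^sub>v (\<rho> g *\<^sub>v (A *\<^sub>v w))"
          using w A GL(1)[OF g] unfolding gA[OF g]
          by (subst assoc_mult_mat_vec[of _ n n _ n], auto)
        finally show "A *\<^sub>v (\<rho> g *\<^sub>v w) = 1 \<cdot>\<^sub>v (\<rho> g *\<^sub>v w)" using w by simp
      qed
      moreover have "A = 0\<^sub>m n n" if "{w \<in> carrier_vec n. A *\<^sub>v w = 1 \<cdot>\<^sub>v w} = {0\<^sub>v n}"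
      proof (rule eq_matI)
        fix i j assume "i < dim_row (0\<^sub>m n n :: complex mat)" "j < dim_col (0\<^sub>m n n :: complex mat)"
        hence ij: "i < n" "j < n" by auto
        have "A *\<^sub>v col A j = col A j" using A ij col_mult2[of A n n A n j] by simp
        hence "col A j \<in> {w \<in> carrier_vec n. A *\<^sub>v w = 1 \<cdot>\<^sub>v w}" using A ij by auto
        hence "col A j = 0\<^sub>v n" using that by auto
        hence "col A j $ i = 0" using ij by simp
        thus "A $$ (i, j) = 0\<^sub>m n n $$ (i, j)" using A ij by simp
      qed (use A in auto)
      moreover have "A \<noteq> 0\<^sub>m n n"
      proof
        assume "A = 0\<^sub>m n n"
        hence "to_mat n n e = to_mat n n 0" by (auto simp: A_def to_mat_def intro!: eq_matI)
        thus False using to_mat_inject[OF e(1) Mat_zero] e(3) by simp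
      qed
      ultimately have "to_mat n n e = to_mat n n (idm n)" by (auto simp: A_def)
      thus ?thesis using to_mat_inject[OF e(1) idm_M] by simp
    qed
    show "\<exists>c. z = sc c (idm n)"
      if z: "z \<in> M n" and gz: "\<And>g. g \<in> carrier G \<Longrightarrow> of_mat (\<rho> g) * z = z * of_mat (\<rho> g)" for z
    proof -
      define A where "A = to_mat n n z"
      have A: "A \<in> carrier_mat n n" by (simp add: A_def)
      have gA: "\<rho> g * A = A * \<rho> g" if g: "g \<in> carrier G" for g
      proof -
        have "of_mat (\<rho> g) \<in> M n" using GL(1)[OF g] by simp
        thus ?thesis using arg_cong[OF gz[OF g], of "to_mat n n"] z toR[OF g]
          by (simp add: to_mat_mult[of _ n n] A_def)
      qed
      obtain c where "eigenvalue A c" using spectrum_non_empty[OF A n] by (auto simp: spectrum_def)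
      then obtain v where v: "v \<in> carrier_vec n" "v \<noteq> 0\<^sub>v n" "A *\<^sub>v v = c \<cdot>\<^sub>v v"
        using A by (auto simp: eigenvalue_def eigenvector_def)
      have "{w \<in> carrier_vec n. A *\<^sub>v w = c \<cdot>\<^sub>v w} = {0\<^sub>v n} \<or> A = c \<cdot>\<^sub>m 1\<^sub>m n"
      proof (rule eig[OF A])
        fix g w assume g: "g \<in> carrier G" and w: "w \<in> carrier_vec n" "A *\<^sub>v w = c \<cdot>\<^sub>v w"
        have "A *\<^sub>v (\<rho> g *\<^sub>v w) = (A * \<rho> g) *\<^sub>v w"
          using w A GL(1)[OF g] by (simp add: assoc_mult_mat_vec[of _ n n _ n])
        also have "\<dots> = \<rho> g *\<^sub>v (A *\<^sub>v w)"
          using w A GL(1)[OF g] by (simp add: assoc_mult_mat_vec[of _ n n _ n] flip: gA[OF g])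
        finally show "A *\<^sub>v (\<rho> g *\<^sub>v w) = c \<cdot>\<^sub>v (\<rho> g *\<^sub>v w)"
          using w GL(1)[OF g] by (simp add: mult_mat_vec)
      qed
      hence "A = c \<cdot>\<^sub>m 1\<^sub>m n" using v by blast
      hence "to_mat n n z = to_mat n n (sc c (idm n))" by (simp add: A_def to_mat_sc)
      thus ?thesis using to_mat_inject[OF z] by (metis Mat_sc idm_M)
    qed
  qed (use assms n GL(1) one of_mat_one in auto)
qed

theorem corollaryM:
  fixes G :: "('a, 'b) monoid_scheme" (structure)
    and \<chi> :: "'a \<Rightarrow> complex"
    and d :: nat
  assumes "group G" and "finite (carrier G)" and "solvable G"
    and "\<chi> \<in> Irr G" and "primitive_character G \<chi>"
    and "\<chi> \<one> = of_nat d" and "odd d"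
  shows "\<forall>x\<in>carrier G. \<forall>m::int. cmod (\<chi> x) \<le> cmod (\<chi> (x [^] m))"
proof -
  obtain n \<rho> where \<chi>: "\<chi> = afforded_character G \<rho>" and irr_\<rho>: "irreducible_mat_rep G n \<rho>"
    using assms(4) by (auto simp: Irr_def)
  define R where "R g = of_mat (\<rho> g)" for g
  interpret irr_rep G n R
    unfolding R_def by (rule irr_rep_of_mat[OF assms(1,2) irr_\<rho>])
  have "\<rho> g \<in> carrier_mat n n" if "g \<in> carrier G" for g
    using mat_rep_carrier[of G n \<rho> g] irr_\<rho> that by (auto simp: irreducible_mat_rep_def)
  hence "mat_trace (\<rho> g) = tr (R g)" if "g \<in> carrier G" for g
    using tr_of_mat[of "\<rho> g" n] that by (simp add: R_def)
  hence \<chi>_tr: "\<chi> = (\<lambda>g\<in>carrier G. tr (R g))"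
    by (auto simp: \<chi> afforded_character_def)
  have "of_nat n = (of_nat d :: complex)" using assms(6) by (simp add: \<chi>_tr R_one)
  hence "odd n" using assms(7) by simp
  interpret prim_rep G n R
  proof
    fix I assume "idempotent_system I"
    thus "I = {idm n}"
      using idempotent_system_induced[of I] assms(5) by (auto simp: \<chi>_tr primitive_character_def)
  qed
  show ?thesis
    using norm_tr_le_norm_tr_power[OF assms(3) \<open>odd n\<close>] by (simp add: \<chi>_tr)
qed

end
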